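(* Let $q$ be an integer, let $G$ be a profinite group, and let $A$ be a special $\lambda$-ring equipped with a $\mathbb Q$-algebra structure. Then for every open subgroup $U$ of $G$, $$q\text{-}{\rm Ind}_U^G={\rm Ind}_U^G$$ as maps $A^{\mathcal O(U)}\to A^{\mathcal O(G)}$.
   Context: For a profinite group $G$: $\varphi_U(X)=|X^U|$ for a $G$-space $X$; $\mathcal O(G)$ is the set of conjugacy classes $[U]$ of open subgroups, ordered by $[V]\preceq[U]$ iff $U$ lies in some $G$-conjugate of $V$; for $[V]\preceq[U]$, $(V:U):=(G:U)/(G:V)$. ${\rm Gh}(G,A)=A^{\mathcal O(G)}$ with componentwise operations; $\Psi^n$ is the $n$-th Adams operation; $q^0=1$ always. The map $\tilde\varphi^q=\tilde\varphi^q_{(G)}:A^{\mathcal O(G)}\to{\rm Gh}(G,A)$ is $\tilde\varphi^q({\bf x})([U])=\sum_{[V]\preceq[U]}\varphi_U(G/V)q^{(V:U)-1}\Psi^{(V:U)}({\bf x}([V]))$; it is bijective when $A$ is a $\mathbb Q$-algebra. The same definitions apply to the profinite group $U$. Classical induction: ${\rm Ind}_U^G({\bf x})([W])=\sum{\bf x}([V])$, the sum over $[V]\in\mathcal O(U)$ with $[V]=[W]$ in $\mathcal O(G)$. Ghost induction $\nu_U^G:{\rm Gh}(U,A)\to{\rm Gh}(G,A)$: $\nu_U^G({\bf x})([W])=\sum[N_G(V):N_U(V)]\,{\bf x}([V])$, the sum over $[V]\in\mathcal O(U)$ with $[V]=[W]$ in $\mathcal O(G)$, where $N_G(V),N_U(V)$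 are normalizers. For $A$ a $\mathbb Q$-algebra, $q$-induction is defined by $q\text{-}{\rm Ind}_U^G:=(\tilde\varphi^q_{(G)})^{-1}\circ\nu_U^G\circ\tilde\varphi^q_{(U)}$. *)

theory Defs
  imports
    "HOL-Analysis.Abstract_Topological_Spaces"
    "HOL-Library.Poly_Mapping"
    "HOL-Algebra.Left_Coset"
    "HOL-Algebra.Group_Action"
    "HOL-Algebra.Module"
    "HOL-Algebra.Algebraic_Closure_Type"
begin

section \<open>Profinite groups and conjugacy classes of open subgroups\<close>

locale topological_group = group G for G :: "('g, 'm) monoid_scheme" (structure) and T :: "'g topology" +
  assumes topspace_eq: "topspace T = carrier G"
    and continuous_mult: "continuous_map (prod_topology T T) T (\<lambda>(x, y). x \<otimes> y)"
    and continuous_inv: "continuous_map T T (\<lambda>x. inv x)"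

locale profinite_group = topological_group +
  assumes compact: "compact_space T"
    and Hausdorff: "Hausdorff_space T"
    and totally_disconnected: "\<And>x. x \<in> carrier G \<Longrightarrow> connected_component_of_set T x = {x}"

definition open_subgroup :: "('g, 'm) monoid_scheme \<Rightarrow> 'g topology \<Rightarrow> 'g set \<Rightarrow> bool"
  where "open_subgroup G T U \<longleftrightarrow> subgroup U G \<and> openin T U"

definition conjugacy_class :: "('g, 'm) monoid_scheme \<Rightarrow> 'g set \<Rightarrow> 'g set set"
  where "conjugacy_class G U = {g <#\<^bsub>G\<^esub> U #>\<^bsub>G\<^esub> inv\<^bsub>G\<^esub> g | g. g \<in> carrier G}"

definition open_classes :: "('g, 'm) monoid_scheme \<Rightarrow> 'g topology \<Rightarrow> 'g set set set"
  where "open_classes G T = conjugacy_class G ` {U. open_subgroup G T U}"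

text \<open>The quantities below attached to a class do not depend on the representative,
  so they are computed at a chosen one.\<close>

definition rep :: "'g set set \<Rightarrow> 'g set"
  where "rep c = (SOME U. U \<in> c)"

definition class_le :: "('g, 'm) monoid_scheme \<Rightarrow> 'g set set \<Rightarrow> 'g set set \<Rightarrow> bool"
  where "class_le G d c \<longleftrightarrow>
    (\<exists>g\<in>carrier G. rep c \<subseteq> g <#\<^bsub>G\<^esub> rep d #>\<^bsub>G\<^esub> inv\<^bsub>G\<^esub> g)"

definition group_index :: "('g, 'm) monoid_scheme \<Rightarrow> 'g set \<Rightarrow> nat"
  where "group_index G U = card (rcosets\<^bsub>G\<^esub> U)"

text \<open>\<open>(V : U) = (G : U) / (G : V)\<close>; the division is exact when \<open>U\<close> lies in a
  conjugate of \<open>V\<close>, the only case in which it is used.\<close>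

definition rel_index :: "('g, 'm) monoid_scheme \<Rightarrow> 'g set \<Rightarrow> 'g set \<Rightarrow> nat"
  where "rel_index G V U = group_index G U div group_index G V"

definition fixed_points :: "'x set \<Rightarrow> ('g \<Rightarrow> 'x \<Rightarrow> 'x) \<Rightarrow> 'g set \<Rightarrow> 'x set"
  where "fixed_points E act U = {x \<in> E. \<forall>u\<in>U. act u x = x}"

text \<open>\<open>mark G U V\<close> is \<open>\<phi>\<^sub>U(G/V)\<close>.\<close>

definition mark :: "('g, 'm) monoid_scheme \<Rightarrow> 'g set \<Rightarrow> 'g set \<Rightarrow> nat"
  where "mark G U V = card (fixed_points (lcosets\<^bsub>G\<^esub> V) (\<lambda>g C. g <#\<^bsub>G\<^esub> C) U)"


section \<open>Special lambda-rings and Adams operations\<close>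

text \<open>Multivariate polynomials over the integers in variables indexed by \<open>'v\<close>.\<close>

type_synonym 'v zpoly = "('v \<Rightarrow>\<^sub>0 nat) \<Rightarrow>\<^sub>0 int"

definition zvar :: "'v \<Rightarrow> 'v zpoly"
  where "zvar v = Poly_Mapping.single (Poly_Mapping.single v 1) 1"

definition zvars :: "'v zpoly \<Rightarrow> 'v set"
  where "zvars p = (\<Union>m \<in> Poly_Mapping.keys p. Poly_Mapping.keys m)"

definition zsubst :: "('v \<Rightarrow> 'w zpoly) \<Rightarrow> 'v zpoly \<Rightarrow> 'w zpoly"
  where "zsubst f p = (\<Sum>m \<in> Poly_Mapping.keys p.
    of_int (Poly_Mapping.lookup p m) *
      (\<Prod>v \<in> Poly_Mapping.keys m. f v ^ Poly_Mapping.lookup m v))"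

definition zeval :: "('a, 'b) ring_scheme \<Rightarrow> ('v \<Rightarrow> 'a) \<Rightarrow> 'v zpoly \<Rightarrow> 'a"
  where "zeval R f p = (\<Oplus>\<^bsub>R\<^esub>m \<in> Poly_Mapping.keys p.
    [Poly_Mapping.lookup p m] \<cdot>\<^bsub>R\<^esub>
      (\<Otimes>\<^bsub>R\<^esub>v \<in> Poly_Mapping.keys m. f v [^]\<^bsub>R\<^esub> Poly_Mapping.lookup m v))"

definition esym :: "nat \<Rightarrow> ('i \<Rightarrow> 'v zpoly) \<Rightarrow> 'i set \<Rightarrow> 'v zpoly"
  where "esym k x I = (\<Sum>S | S \<subseteq> I \<and> card S = k. \<Prod>i\<in>S. x i)"

text \<open>The universal polynomial \<open>P\<^sub>n(s\<^sub>1,\<dots>,s\<^sub>n; t\<^sub>1,\<dots>,t\<^sub>n)\<close>: for \<open>s\<^sub>i\<close>, \<open>t\<^sub>i\<close> the elementary symmetric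
  polynomials in \<open>x\<^sub>1,\<dots>,x\<^sub>n\<close> and in \<open>y\<^sub>1,\<dots>,y\<^sub>n\<close>, it is the coefficient of \<open>t\<^sup>n\<close> in the product of all
  \<open>1 + x\<^sub>i y\<^sub>j t\<close>. Variables \<open>Inl i\<close> stand for \<open>s\<^sub>i\<close>, \<open>x\<^sub>i\<close>, and \<open>Inr i\<close> for \<open>t\<^sub>i\<close>, \<open>y\<^sub>i\<close>. Existence and
  uniqueness of this polynomial, and of the next one, is the fundamental theorem on symmetric
  polynomials.\<close>

definition lambda_mult_poly :: "nat \<Rightarrow> (nat + nat) zpoly"
  where "lambda_mult_poly n = (THE p.
    zvars p \<subseteq> Inl ` {1..n} \<union> Inr ` {1..n} \<and>
    zsubst (case_sum (\<lambda>i. esym i (\<lambda>j. zvar (Inl j :: nat + nat)) {1..n})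
                     (\<lambda>i. esym i (\<lambda>j. zvar (Inr j :: nat + nat)) {1..n})) p
      = esym n (\<lambda>(i, j). zvar (Inl i) * zvar (Inr j)) ({1..n} \<times> {1..n}))"

text \<open>The universal polynomial \<open>P\<^sub>m\<^sub>,\<^sub>n(s\<^sub>1,\<dots>,s\<^sub>m\<^sub>n)\<close>: for \<open>s\<^sub>i\<close> the elementary symmetric polynomials in
  \<open>x\<^sub>1,\<dots>,x\<^sub>m\<^sub>n\<close>, it is the coefficient of \<open>t\<^sup>m\<close> in the product of \<open>1 + (\<Prod>i\<in>S. x\<^sub>i) t\<close> over all
  \<open>n\<close>-element sets \<open>S\<close> of indices.\<close>

definition lambda_comp_poly :: "nat \<Rightarrow> nat \<Rightarrow> nat zpoly"
  where "lambda_comp_poly m n = (THE p.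
    zvars p \<subseteq> {1..m * n} \<and>
    zsubst (\<lambda>i. esym i zvar {1..m * n}) p
      = esym m (\<lambda>S. \<Prod>i\<in>S. zvar i) {S. S \<subseteq> {1..m * n} \<and> card S = n})"

locale lambda_ring = cring R for R :: "('a, 'b) ring_scheme" (structure) and lam :: "nat \<Rightarrow> 'a \<Rightarrow> 'a" +
  assumes lam_closed: "x \<in> carrier R \<Longrightarrow> lam n x \<in> carrier R"
    and lam_0: "x \<in> carrier R \<Longrightarrow> lam 0 x = \<one>"
    and lam_1: "x \<in> carrier R \<Longrightarrow> lam 1 x = x"
    and lam_add: "x \<in> carrier R \<Longrightarrow> y \<in> carrier R \<Longrightarrow>
      lam n (x \<oplus> y) = (\<Oplus>i\<in>{..n}. lam i x \<otimes> lam (n - i) y)"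

locale special_lambda_ring = lambda_ring +
  assumes lam_one: "n \<ge> 2 \<Longrightarrow> lam n \<one> = \<zero>"
    and lam_mult: "x \<in> carrier R \<Longrightarrow> y \<in> carrier R \<Longrightarrow> n \<ge> 1 \<Longrightarrow>
      lam n (x \<otimes> y) = zeval R (case_sum (\<lambda>i. lam i x) (\<lambda>i. lam i y)) (lambda_mult_poly n)"
    and lam_lam: "x \<in> carrier R \<Longrightarrow> m \<ge> 1 \<Longrightarrow> n \<ge> 1 \<Longrightarrow>
      lam m (lam n x) = zeval R (\<lambda>i. lam i x) (lambda_comp_poly m n)"

text \<open>Logarithmic derivative of a power series \<open>f\<close> (given by its coefficients) with constant
  term \<open>1\<close>: the unique power series \<open>g\<close> over \<open>R\<close> with \<open>f' = f g\<close>.\<close>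

definition log_deriv :: "('a, 'b) ring_scheme \<Rightarrow> (nat \<Rightarrow> 'a) \<Rightarrow> nat \<Rightarrow> 'a"
  where "log_deriv R f = (THE g. (\<forall>n. g n \<in> carrier R) \<and>
    (\<forall>n. [Suc n] \<cdot>\<^bsub>R\<^esub> f (Suc n) = (\<Oplus>\<^bsub>R\<^esub>i\<in>{..n}. f i \<otimes>\<^bsub>R\<^esub> g (n - i))))"

text \<open>The Adams operations \<open>\<Psi>\<^sup>n\<close>, \<open>n \<ge> 1\<close>: with \<open>\<lambda>\<^sub>t(x) = \<Sum>\<^sub>n \<lambda>\<^sup>n(x) t\<^sup>n\<close>,
  \<open>d/dt log \<lambda>\<^sub>t(x) = \<Sum>\<^sub>n (-1)\<^sup>n \<Psi>\<^sup>n\<^sup>+\<^sup>1(x) t\<^sup>n\<close>.\<close>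

definition adams :: "('a, 'b) ring_scheme \<Rightarrow> (nat \<Rightarrow> 'a \<Rightarrow> 'a) \<Rightarrow> nat \<Rightarrow> 'a \<Rightarrow> 'a"
  where "adams R lam n x =
    [((-1 :: int) ^ (n - 1))] \<cdot>\<^bsub>R\<^esub> log_deriv R (\<lambda>i. lam i x) (n - 1)"


section \<open>Ghost maps and inductions\<close>

text \<open>\<open>A\<^sup>O\<^sup>(\<^sup>G\<^sup>)\<close>, which is also the underlying set of the ghost ring \<open>Gh(G,A)\<close>.\<close>

definition class_functions ::
    "('g, 'm) monoid_scheme \<Rightarrow> 'g topology \<Rightarrow> ('a, 'b) ring_scheme \<Rightarrow> ('g set set \<Rightarrow> 'a) set"
  where "class_functions G T A = open_classes G T \<rightarrow>\<^sub>E carrier A"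

definition ghost_map ::
    "int \<Rightarrow> ('g, 'm) monoid_scheme \<Rightarrow> 'g topology \<Rightarrow> ('a, 'b) ring_scheme \<Rightarrow>
      (nat \<Rightarrow> 'a \<Rightarrow> 'a) \<Rightarrow> ('g set set \<Rightarrow> 'a) \<Rightarrow> 'g set set \<Rightarrow> 'a"
  where "ghost_map q G T A lam x = (\<lambda>c \<in> open_classes G T.
    \<Oplus>\<^bsub>A\<^esub>d \<in> {d \<in> open_classes G T. class_le G d c}.
      [(int (mark G (rep c) (rep d)) * q ^ (rel_index G (rep d) (rep c) - 1))] \<cdot>\<^bsub>A\<^esub>
        adams A lam (rel_index G (rep d) (rep c)) (x d))"

text \<open>The profinite group structure on an open subgroup \<open>U\<close> of \<open>G\<close> is given by
  \<open>G\<lparr>carrier := U\<rparr>\<close> and \<open>subtopology T U\<close>. The next set consists of the classes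
  \<open>[V] \<in> O(U)\<close> with \<open>[V] = c\<close> in \<open>O(G)\<close>.\<close>

definition classes_over ::
    "('g, 'm) monoid_scheme \<Rightarrow> 'g topology \<Rightarrow> 'g set \<Rightarrow> 'g set set \<Rightarrow> 'g set set set"
  where "classes_over G T U c =
    {d \<in> open_classes (G\<lparr>carrier := U\<rparr>) (subtopology T U). conjugacy_class G (rep d) = c}"

definition classical_ind ::
    "('g, 'm) monoid_scheme \<Rightarrow> 'g topology \<Rightarrow> 'g set \<Rightarrow> ('a, 'b) ring_scheme \<Rightarrow>
      ('g set set \<Rightarrow> 'a) \<Rightarrow> 'g set set \<Rightarrow> 'a"
  where "classical_ind G T U A x = (\<lambda>c \<in> open_classes G T.
    \<Oplus>\<^bsub>A\<^esub>d \<in> classes_over G T U c. x d)"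

definition normalizer_index :: "('g, 'm) monoid_scheme \<Rightarrow> 'g set \<Rightarrow> 'g set \<Rightarrow> nat"
  where "normalizer_index G U V =
    group_index (G\<lparr>carrier := normalizer G V\<rparr>) (normalizer (G\<lparr>carrier := U\<rparr>) V)"

definition ghost_ind ::
    "('g, 'm) monoid_scheme \<Rightarrow> 'g topology \<Rightarrow> 'g set \<Rightarrow> ('a, 'b) ring_scheme \<Rightarrow>
      ('g set set \<Rightarrow> 'a) \<Rightarrow> 'g set set \<Rightarrow> 'a"
  where "ghost_ind G T U A x = (\<lambda>c \<in> open_classes G T.
    \<Oplus>\<^bsub>A\<^esub>d \<in> classes_over G T U c. [normalizer_index G U (rep d)] \<cdot>\<^bsub>A\<^esub> x d)"

definition q_ind ::
    "int \<Rightarrow> ('g, 'm) monoid_scheme \<Rightarrow> 'g topology \<Rightarrow> 'g set \<Rightarrow> ('a, 'b) ring_scheme \<Rightarrow>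
      (nat \<Rightarrow> 'a \<Rightarrow> 'a) \<Rightarrow> ('g set set \<Rightarrow> 'a) \<Rightarrow> 'g set set \<Rightarrow> 'a"
  where "q_ind q G T U A lam =
    inv_into (class_functions G T A) (ghost_map q G T A lam) \<circ> ghost_ind G T U A \<circ>
      ghost_map q (G\<lparr>carrier := U\<rparr>) (subtopology T U) A lam"

end

theory Submission
  imports Defs "HOL-Algebra.UnivPoly"
begin

text \<open>Both inductions are compared after applying the ghost map of \<open>G\<close>, which is injective on a
  \<open>\<rat>\<close>-algebra because it is triangular for the index, with positive integers on the diagonal.
  As the Adams operations are additive, \<open>\<phi>\<^sub>G(Ind x)\<close> at \<open>[W]\<close> is a sum over \<open>[V] \<in> O(U)\<close> with
  coefficients \<open>\<phi>\<^sub>W(G/V)\<close>. The identity then reduces to the count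
  \<open>\<phi>\<^sub>W(G/V) = \<Sum> [N\<^sub>G(K) : N\<^sub>U(K)] \<phi>\<^sub>K(U/V)\<close>, the sum over \<open>[K] \<in> O(U)\<close> with \<open>K\<close> conjugate to
  \<open>W\<close> in \<open>G\<close>, which sorts the fixed points \<open>g V\<close> of \<open>W\<close> by the class of \<open>g\<^sup>-\<^sup>1 W g\<close> in \<open>U\<close>.\<close>

section \<open>Conjugates, indices and marks\<close>

text \<open>The parameter \<open>q\<close> drops out because the index (V : W) is the same number
  whether computed in \<open>U\<close> or in \<open>G\<close>: both indices acquire the factor (G :
  U), which cancels. For a fixed class [V] of \<open>U\<close>, the power of \<open>q\<close> and
  the Adams value of x at [V] are therefore common to all its contributions at [W], on either side,
  and only integer multiplicities built from marks have to be compared. The weights of ghost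
  induction count the ways to carry K to W by conjugation in \<open>G\<close>: such elements form a
  coset of the normalizer of K, and two of them that differ by an element of \<open>U\<close> in
  that normalizer lead to the same fixed points. Data attached to a class is evaluated at the
  subgroup picked by \<open>rep\<close>, and the one picked for a class of \<open>U\<close> need not
  be the one picked for the class it generates in \<open>G\<close>; hence the need for invariance of
  indices and marks under conjugation. The vector to be inverted is exhibited as the ghost vector of
  Ind x, so injectivity determines the value of \<open>inv_into\<close> there.\<close>

definition conjugate :: "('g, 'm) monoid_scheme \<Rightarrow> 'g \<Rightarrow> 'g set \<Rightarrow> 'g set"
  where "conjugate G g V = g <#\<^bsub>G\<^esub> V #>\<^bsub>G\<^esub> inv\<^bsub>G\<^esub> g"

lemma conjugacy_class_eq: "conjugacy_class G V = (\<lambda>g. conjugate G g V) ` carrier G"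
  by (auto simp: conjugacy_class_def conjugate_def)

lemma class_le_iff: "class_le G d c \<longleftrightarrow> (\<exists>g\<in>carrier G. rep c \<subseteq> conjugate G g (rep d))"
  by (simp add: class_le_def conjugate_def)

context group
begin

lemma mult_inv_cancel_left:
  assumes "g \<in> carrier G" "x \<in> carrier G"
  shows "g \<otimes> (inv g \<otimes> x) = x" "inv g \<otimes> (g \<otimes> x) = x"
  using assms by (simp_all add: m_assoc[symmetric])

lemma l_coset_mem_iff:
  assumes "V \<subseteq> carrier G" "g \<in> carrier G"
  shows "x \<in> g <# V \<longleftrightarrow> x \<in> carrier G \<and> inv g \<otimes> x \<in> V"
proof
  assume "x \<in> g <# V"
  then obtain v where "v \<in> V" "x = g \<otimes> v" by (auto simp: l_coset_def)
  then show "x \<in> carrier G \<and> inv g \<otimes> x \<in> V"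
    using assms by (auto simp: m_assoc[symmetric] subset_iff)
next
  assume "x \<in> carrier G \<and> inv g \<otimes> x \<in> V"
  then show "x \<in> g <# V"
    using assms by (auto simp: l_coset_def m_assoc[symmetric] intro!: bexI[of _ "inv g \<otimes> x"])
qed

lemma r_coset_mem_iff:
  assumes "V \<subseteq> carrier G" "g \<in> carrier G"
  shows "x \<in> V #> g \<longleftrightarrow> x \<in> carrier G \<and> x \<otimes> inv g \<in> V"
proof
  assume "x \<in> V #> g"
  then obtain v where "v \<in> V" "x = v \<otimes> g" by (auto simp: r_coset_def)
  then show "x \<in> carrier G \<and> x \<otimes> inv g \<in> V"
    using assms by (auto simp: m_assoc subset_iff)
next
  assume "x \<in> carrier G \<and> x \<otimes> inv g \<in> V"
  then show "x \<in> V #> g"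
    using assms by (auto simp: r_coset_def m_assoc intro!: bexI[of _ "x \<otimes> inv g"])
qed

lemma conjugate_mem_iff:
  assumes "V \<subseteq> carrier G" "g \<in> carrier G"
  shows "x \<in> conjugate G g V \<longleftrightarrow> x \<in> carrier G \<and> inv g \<otimes> x \<otimes> g \<in> V"
  using assms by (auto simp: conjugate_def r_coset_mem_iff l_coset_mem_iff l_coset_subset_G m_assoc)

lemma conjugate_subset:
  "V \<subseteq> carrier G \<Longrightarrow> g \<in> carrier G \<Longrightarrow> conjugate G g V \<subseteq> carrier G"
  by (auto simp: conjugate_mem_iff)

lemma conjugate_mono: "V \<subseteq> W \<Longrightarrow> conjugate G g V \<subseteq> conjugate G g W"
  by (auto simp: conjugate_def l_coset_def r_coset_def)

lemma conjugate_one [simp]: "V \<subseteq> carrier G \<Longrightarrow> conjugate G \<one> V = V"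
  by (auto simp: conjugate_mem_iff subset_iff)

lemma conjugate_conjugate:
  assumes "V \<subseteq> carrier G" "g \<in> carrier G" "h \<in> carrier G"
  shows "conjugate G g (conjugate G h V) = conjugate G (g \<otimes> h) V"
  using assms by (auto simp: conjugate_mem_iff conjugate_subset inv_mult_group m_assoc)

lemma conjugate_inv_cancel [simp]:
  assumes "V \<subseteq> carrier G" "g \<in> carrier G"
  shows "conjugate G (inv g) (conjugate G g V) = V" "conjugate G g (conjugate G (inv g) V) = V"
  using assms by (simp_all add: conjugate_conjugate)

lemma subset_conjugate_iff:
  assumes "V \<subseteq> carrier G" "W \<subseteq> carrier G" "g \<in> carrier G"
  shows "W \<subseteq> conjugate G g V \<longleftrightarrow> conjugate G (inv g) W \<subseteq> V"
  using assms by (metis conjugate_inv_cancel conjugate_mono)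

lemma subgroup_conjugate:
  assumes "subgroup V G" "g \<in> carrier G"
  shows "subgroup (conjugate G g V) G"
proof -
  interpret V: subgroup V G by fact
  have sub: "V \<subseteq> carrier G" by (rule V.subset)
  show ?thesis
  proof (unfold_locales, goal_cases)
    case 1 show ?case using sub assms(2) by (rule conjugate_subset)
  next
    case (2 x y)
    then have "x \<in> carrier G" "y \<in> carrier G" "inv g \<otimes> x \<otimes> g \<in> V" "inv g \<otimes> y \<otimes> g \<in> V"
      using sub assms by (auto simp: conjugate_mem_iff)
    moreover from this have "(inv g \<otimes> x \<otimes> g) \<otimes> (inv g \<otimes> y \<otimes> g) \<in> V" by simp
    moreover have "(inv g \<otimes> x \<otimes> g) \<otimes> (inv g \<otimes> y \<otimes> g) = inv g \<otimes> (x \<otimes> y) \<otimes> g"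
      using \<open>x \<in> carrier G\<close> \<open>y \<in> carrier G\<close> assms by (simp add: m_assoc mult_inv_cancel_left)
    ultimately show ?case
      using sub assms by (simp add: conjugate_mem_iff m_assoc)
  next
    case 3 then show ?case using sub assms by (simp add: conjugate_mem_iff)
  next
    case (4 x)
    then have *: "x \<in> carrier G" "inv g \<otimes> x \<otimes> g \<in> V"
      using sub assms by (auto simp: conjugate_mem_iff)
    then have "inv (inv g \<otimes> x \<otimes> g) \<in> V" by blast
    then show ?case
      using * sub assms by (simp add: conjugate_mem_iff inv_mult_group m_assoc)
  qed
qed

lemma mem_conjugacy_class_self:
  "V \<subseteq> carrier G \<Longrightarrow> V \<in> conjugacy_class G V"
  unfolding conjugacy_class_eq by (rule image_eqI[of _ _ \<one>]) auto

lemma conjugacy_class_conjugate: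
  assumes "V \<subseteq> carrier G" "g \<in> carrier G"
  shows "conjugacy_class G (conjugate G g V) = conjugacy_class G V"
proof -
  have sub: "conjugacy_class G (conjugate G h W) \<subseteq> conjugacy_class G W"
    if "W \<subseteq> carrier G" "h \<in> carrier G" for h W
    using that by (auto simp: conjugacy_class_eq conjugate_conjugate)
  show ?thesis
    using sub[OF assms] sub[of "conjugate G g V" "inv g"] assms by (auto simp: conjugate_subset)
qed

lemma conjugacy_class_eq_iff:
  assumes "V \<subseteq> carrier G" "W \<subseteq> carrier G"
  shows "conjugacy_class G V = conjugacy_class G W \<longleftrightarrow> (\<exists>g\<in>carrier G. V = conjugate G g W)"
proof
  assume "conjugacy_class G V = conjugacy_class G W"
  then have "V \<in> conjugacy_class G W"
    using mem_conjugacy_class_self[OF assms(1)] by simp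
  then show "\<exists>g\<in>carrier G. V = conjugate G g W"
    by (auto simp: conjugacy_class_eq)
next
  assume "\<exists>g\<in>carrier G. V = conjugate G g W"
  then show "conjugacy_class G V = conjugacy_class G W"
    using conjugacy_class_conjugate[OF assms(2)] by blast
qed

lemma rep_conjugacy_class:
  assumes "V \<subseteq> carrier G"
  obtains g where "g \<in> carrier G" "rep (conjugacy_class G V) = conjugate G g V"
proof -
  have "rep (conjugacy_class G V) \<in> conjugacy_class G V"
    unfolding rep_def using mem_conjugacy_class_self[OF assms] by (rule someI)
  then show ?thesis using that by (auto simp: conjugacy_class_eq)
qed

lemma subgroup_subset_carrier_update:
  "subgroup U G \<Longrightarrow> subgroup V (G\<lparr>carrier := U\<rparr>) \<longleftrightarrow> subgroup V G \<and> V \<subseteq> U"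
  using incl_subgroup[of U V] subgroup_incl[of V U] subgroup.subset[of V "G\<lparr>carrier := U\<rparr>"] by auto

lemma conjugate_carrier_update:
  "subgroup U G \<Longrightarrow> u \<in> U \<Longrightarrow> conjugate (G\<lparr>carrier := U\<rparr>) u V = conjugate G u V"
  by (simp add: conjugate_def m_inv_consistent)

lemma l_coset_eq_iff:
  assumes "subgroup V G" "g \<in> carrier G" "h \<in> carrier G"
  shows "(g <# V) = (h <# V) \<longleftrightarrow> inv h \<otimes> g \<in> V"
proof
  assume "(g <# V) = (h <# V)"
  then have "g \<in> h <# V" using lcos_self assms by blast
  then show "inv h \<otimes> g \<in> V"
    using assms by (simp add: l_coset_mem_iff subgroup.subset)
next
  assume "inv h \<otimes> g \<in> V"
  then have "g \<in> h <# V"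
    using assms by (simp add: l_coset_mem_iff subgroup.subset)
  then show "(g <# V) = (h <# V)"
    using assms l_repr_independence by blast
qed

lemma r_coset_eq_iff:
  assumes "subgroup V G" "g \<in> carrier G" "h \<in> carrier G"
  shows "V #> g = V #> h \<longleftrightarrow> g \<otimes> inv h \<in> V"
proof
  assume "V #> g = V #> h"
  then have "g \<in> V #> h" using rcos_self assms by blast
  then show "g \<otimes> inv h \<in> V"
    using assms by (simp add: r_coset_mem_iff subgroup.subset)
next
  assume "g \<otimes> inv h \<in> V"
  then have "g \<in> V #> h"
    using assms by (simp add: r_coset_mem_iff subgroup.subset)
  then show "V #> g = V #> h"
    using assms repr_independence by blast
qed

end

section \<open>Coset counting: indices and marks\<close>

context group
begin

lemma inj_on_l_coset: "g \<in> carrier G \<Longrightarrow> inj_on (\<lambda>C. g <# C) (Pow (carrier G))"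
  by (rule inj_on_inverseI[of _ "\<lambda>C. inv g <# C"]) (simp add: lcos_m_assoc lcos_mult_one)

lemma inj_on_r_coset: "g \<in> carrier G \<Longrightarrow> inj_on (\<lambda>C. C #> g) (Pow (carrier G))"
  by (rule inj_on_inverseI[of _ "\<lambda>C. C #> inv g"]) (simp add: coset_mult_assoc)

text \<open>Since (g V g^-1) x = g (V (g^-1 x)), left translation by \<open>g\<close> carries the
  right cosets of \<open>V\<close> bijectively to those of the conjugate.\<close>

lemma group_index_conjugate:
  assumes "subgroup V G" "g \<in> carrier G"
  shows "group_index G (conjugate G g V) = group_index G V"
proof -
  have V: "V \<subseteq> carrier G" using assms(1) by (rule subgroup.subset)
  have eq: "conjugate G g V #> x = g <# (V #> (inv g \<otimes> x))" if "x \<in> carrier G" for x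
    using V assms(2) that
    by (auto simp: r_coset_mem_iff l_coset_mem_iff conjugate_subset conjugate_mem_iff
        r_coset_subset_G inv_mult_group m_assoc)
  have eq': "g <# (V #> x) = conjugate G g V #> (g \<otimes> x)" if "x \<in> carrier G" for x
    using eq[of "g \<otimes> x"] that assms(2) by (simp add: mult_inv_cancel_left)
  have "rcosets (conjugate G g V) = (\<lambda>C. g <# C) ` (rcosets V)"
    using assms(2) by (fastforce simp: RCOSETS_def eq eq' image_iff)
  moreover have "inj_on (\<lambda>C. g <# C) (rcosets V)"
    using inj_on_l_coset[OF assms(2)] rcosets_subset_PowG[OF assms(1)] by (rule inj_on_subset)
  ultimately show ?thesis by (simp add: group_index_def card_image)
qed

text \<open>Sending W x to U x is onto the cosets of \<open>U\<close>. It is realized on sets by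
  picking any element of the coset, since that element also lies in U x.\<close>

lemma finite_rcosets_mono:
  assumes "subgroup W G" "subgroup U G" "W \<subseteq> U" "finite (rcosets W)"
  shows "finite (rcosets U)"
proof -
  have "U #> a \<in> (\<lambda>C. U #> (SOME x. x \<in> C)) ` (rcosets W)" if a: "a \<in> carrier G" for a
  proof -
    have "(SOME x. x \<in> W #> a) \<in> W #> a"
      using rcos_self[OF a assms(1)] by (rule someI)
    then have "(SOME x. x \<in> W #> a) \<in> U #> a"
      using assms(3) by (auto simp: r_coset_def)
    then have "U #> a = U #> (SOME x. x \<in> W #> a)"
      using a assms(2) by (rule repr_independence)
    then show ?thesis
      using a by (auto simp: RCOSETS_def)
  qed
  then have "rcosets U \<subseteq> (\<lambda>C. U #> (SOME x. x \<in> C)) ` (rcosets W)"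
    by (auto simp: RCOSETS_def)
  then show ?thesis using assms(4) finite_surj by blast
qed

lemma rcosets_carrier_update:
  "rcosets\<^bsub>G\<lparr>carrier := U\<rparr>\<^esub> W = (\<lambda>u. W #> u) ` U"
  by (auto simp: RCOSETS_def)

text \<open>The cosets of \<open>W\<close> are sorted by the coset U g that contains them; right
  translation by \<open>g\<close> identifies each fibre with the cosets of \<open>W\<close> in
  \<open>U\<close>, so all fibres have the same size.\<close>

lemma group_index_mult:
  assumes "subgroup W G" "subgroup U G" "W \<subseteq> U" "finite (rcosets W)"
  shows "group_index G W = group_index G U * group_index (G\<lparr>carrier := U\<rparr>) W"
proof -
  have W: "W \<subseteq> carrier G" and U: "U \<subseteq> carrier G"
    using assms subgroup.subset by auto
  interpret U: subgroup U G by fact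
  define R where "R = rcosets\<^bsub>G\<lparr>carrier := U\<rparr>\<^esub> W"
  have R: "R = (\<lambda>u. W #> u) ` U"
    unfolding R_def by (rule rcosets_carrier_update)
  define fib where "fib D = {C \<in> rcosets W. C \<subseteq> D}" for D
  have sub: "W #> x \<subseteq> U #> x" for x
    using assms(3) by (auto simp: r_coset_def)
  have fib: "fib (U #> g) = (\<lambda>C. C #> g) ` R" if g: "g \<in> carrier G" for g
  proof safe
    fix C assume "C \<in> fib (U #> g)"
    then obtain x where x: "x \<in> carrier G" "C = W #> x" "W #> x \<subseteq> U #> g"
      by (auto simp: fib_def RCOSETS_def)
    then have "x \<in> U #> g" using rcos_self[OF x(1) assms(1)] by blast
    then have u: "x \<otimes> inv g \<in> U" using g U by (simp add: r_coset_mem_iff)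
    then have "C = (W #> (x \<otimes> inv g)) #> g"
      using x g W by (simp add: coset_mult_assoc m_assoc)
    then show "C \<in> (\<lambda>C. C #> g) ` R" using u unfolding R by blast
  next
    fix C assume "C \<in> R"
    then obtain u where u: "u \<in> U" "C = W #> u" by (auto simp: R)
    then have "C #> g = W #> (u \<otimes> g)" using g W by (simp add: coset_mult_assoc)
    moreover have "U #> (u \<otimes> g) = U #> g"
      using u g by (simp add: r_coset_eq_iff assms(2) m_assoc)
    ultimately show "C #> g \<in> fib (U #> g)"
      using sub[of "u \<otimes> g"] u g by (auto simp: fib_def RCOSETS_def)
  qed
  have card_fib: "card (fib D) = card R" if D: "D \<in> rcosets U" for D
  proof -
    obtain g where g: "g \<in> carrier G" "D = U #> g" using D by (auto simp: RCOSETS_def)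
    have "R \<subseteq> Pow (carrier G)" using W by (auto simp: R r_coset_mem_iff)
    then have "inj_on (\<lambda>C. C #> g) R"
      using inj_on_r_coset[OF g(1)] inj_on_subset by blast
    then show ?thesis using g by (simp add: fib card_image)
  qed
  have "rcosets W = (\<Union>D\<in>rcosets U. fib D)"
    using sub by (auto simp: RCOSETS_def fib_def)
  moreover have "card (\<Union>D\<in>rcosets U. fib D) = (\<Sum>D\<in>rcosets U. card (fib D))"
  proof (rule card_UN_disjoint)
    show "finite (rcosets U)" by (rule finite_rcosets_mono) fact+
    show "\<forall>D\<in>rcosets U. finite (fib D)" using assms(4) by (simp add: fib_def)
    have "fib D \<inter> fib D' = {}" if "D \<in> rcosets U" "D' \<in> rcosets U" "D \<noteq> D'" for D D'
    proof -
      have "D \<inter> D' = {}"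
        using rcos_disjoint[OF assms(2)] that by (auto simp: pairwise_def disjnt_def)
      then show ?thesis
        using subgroup.rcosets_non_empty[OF assms(1)] by (fastforce simp: fib_def)
    qed
    then show "\<forall>D\<in>rcosets U. \<forall>D'\<in>rcosets U. D \<noteq> D' \<longrightarrow> fib D \<inter> fib D' = {}" by blast
  qed
  ultimately show ?thesis
    by (simp add: group_index_def card_fib R_def)
qed

text \<open>Inversion maps the right coset V g^-1 onto g V. Indices are counted with right cosets
  but marks with left ones, so finiteness has to cross over.\<close>

lemma finite_lcosets:
  assumes "subgroup V G" "finite (rcosets V)"
  shows "finite (lcosets V)"
proof -
  have V: "V \<subseteq> carrier G" using assms(1) by (rule subgroup.subset)
  have "g <# V = m_inv G ` (V #> inv g)" if g: "g \<in> carrier G" for g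
  proof safe
    fix x assume "x \<in> g <# V"
    then obtain v where v: "v \<in> V" "x = g \<otimes> v" by (auto simp: l_coset_def)
    then have "inv v \<in> V" "v \<in> carrier G" using assms(1) V by (auto intro: subgroup.m_inv_closed)
    then have "x = inv (inv v \<otimes> inv g)" using v g by (simp add: inv_mult_group)
    then show "x \<in> m_inv G ` (V #> inv g)" using \<open>inv v \<in> V\<close> by (auto simp: r_coset_def)
  next
    fix x assume "x \<in> V #> inv g"
    then obtain v where v: "v \<in> V" "x = v \<otimes> inv g" by (auto simp: r_coset_def)
    then have "inv v \<in> V" "v \<in> carrier G" using assms(1) V by (auto intro: subgroup.m_inv_closed)
    then show "inv x \<in> g <# V" using v g by (auto simp: inv_mult_group l_coset_def)
  qed
  then have "lcosets V \<subseteq> (\<lambda>C. m_inv G ` C) ` (rcosets V)"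
    using rcosetsI[OF V] by (auto simp: LCOSETS_def)
  then show ?thesis using assms(2) finite_surj by blast
qed

text \<open>The coset g V is fixed by \<open>w\<close> iff g^-1 w g lies in \<open>V\<close>, that
  is, iff \<open>w\<close> lies in g V g^-1. Marks can then be counted through elements
  \<open>g\<close>, the image removing repetitions.\<close>

lemma fixed_points_lcosets:
  assumes "subgroup V G" "W \<subseteq> carrier G"
  shows "fixed_points (lcosets V) (\<lambda>g C. g <# C) W =
    (\<lambda>g. g <# V) ` {g \<in> carrier G. W \<subseteq> conjugate G g V}"
proof -
  have V: "V \<subseteq> carrier G" using assms(1) by (rule subgroup.subset)
  have "(w <# (g <# V)) = (g <# V) \<longleftrightarrow> w \<in> conjugate G g V"
    if "g \<in> carrier G" "w \<in> W" for g w
  proof -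
    have w: "w \<in> carrier G" using that assms(2) by blast
    then have "w <# (g <# V) = (w \<otimes> g) <# V" using that V by (simp add: lcos_m_assoc)
    then show ?thesis
      using that w V by (simp add: l_coset_eq_iff[OF assms(1)] conjugate_mem_iff m_assoc)
  qed
  then show ?thesis
    by (auto simp: fixed_points_def LCOSETS_def)
qed

text \<open>Right translation by h^-1 sends (g h) V to g (h V h^-1) and commutes with the left
  action, so it matches the fixed points. This makes the mark independent of the representative that
  \<open>rep\<close> picks for the orbit.\<close>

lemma mark_conjugate:
  assumes "subgroup V G" "W \<subseteq> carrier G" "h \<in> carrier G"
  shows "mark G W (conjugate G h V) = mark G W V"
proof -
  have V: "V \<subseteq> carrier G" using assms(1) by (rule subgroup.subset)
  have eq: "g <# conjugate G h V = ((g \<otimes> h) <# V) #> inv h" if "g \<in> carrier G" for g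
    using that V assms(3)
    by (auto simp: r_coset_mem_iff l_coset_mem_iff conjugate_subset conjugate_mem_iff
        l_coset_subset_G inv_mult_group m_assoc)
  have "(\<lambda>g. g <# conjugate G h V) ` {g \<in> carrier G. W \<subseteq> conjugate G g (conjugate G h V)} =
    (\<lambda>C. C #> inv h) ` (\<lambda>g. g <# V) ` {g \<in> carrier G. W \<subseteq> conjugate G g V}" (is "?L = ?R")
  proof safe
    fix g assume "g \<in> carrier G" "W \<subseteq> conjugate G g (conjugate G h V)"
    then show "g <# conjugate G h V \<in> ?R"
      using V assms(3) by (auto simp: eq conjugate_conjugate)
  next
    fix g assume "g \<in> carrier G" "W \<subseteq> conjugate G g V"
    then show "(g <# V) #> inv h \<in> ?L"
      using V assms(3)
      by (auto simp: eq conjugate_conjugate m_assoc intro!: image_eqI[of _ _ "g \<otimes> inv h"])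
  qed
  moreover have "inj_on (\<lambda>C. C #> inv h) ((\<lambda>g. g <# V) ` {g \<in> carrier G. W \<subseteq> conjugate G g V})"
    by (rule inj_on_subset[OF inj_on_r_coset]) (use assms(3) V in \<open>auto simp: l_coset_mem_iff\<close>)
  ultimately show ?thesis
    using assms by (simp add: mark_def fixed_points_lcosets subgroup_conjugate card_image)
qed

lemma mark_eq_0:
  assumes "subgroup V G" "W \<subseteq> carrier G" "\<And>g. g \<in> carrier G \<Longrightarrow> \<not> W \<subseteq> conjugate G g V"
  shows "mark G W V = 0"
proof -
  have empty: "{g \<in> carrier G. W \<subseteq> conjugate G g V} = {}" using assms(3) by blast
  show ?thesis unfolding mark_def fixed_points_lcosets[OF assms(1,2)] empty by simp
qed

text \<open>The coset \<open>V\<close> itself is fixed by \<open>V\<close>; finiteness keeps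
  \<open>card\<close> from being 0 by convention.\<close>

lemma mark_self_pos:
  assumes "subgroup V G" "finite (rcosets V)"
  shows "mark G V V > 0"
proof -
  have V: "V \<subseteq> carrier G" using assms(1) by (rule subgroup.subset)
  have "fixed_points (lcosets V) (\<lambda>g C. g <# C) V \<subseteq> lcosets V"
    by (auto simp: fixed_points_def)
  then have "finite (fixed_points (lcosets V) (\<lambda>g C. g <# C) V)"
    using finite_lcosets[OF assms] finite_subset by blast
  moreover have "\<one> <# V \<in> fixed_points (lcosets V) (\<lambda>g C. g <# C) V"
    using V by (auto simp: fixed_points_lcosets[OF assms(1)])
  ultimately show ?thesis
    by (auto simp: mark_def card_gt_0_iff)
qed

lemma normalizer_eq:
  "K \<subseteq> carrier G \<Longrightarrow> normalizer G K = {g \<in> carrier G. conjugate G g K = K}"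
  by (auto simp: normalizer_def stabilizer_def conjugate_def)

end

section \<open>Marks of induced orbits\<close>

context group
begin

lemma normalizer_carrier_update:
  assumes "subgroup U G" "K \<subseteq> U"
  shows "normalizer (G\<lparr>carrier := U\<rparr>) K = normalizer G K \<inter> U"
proof -
  have U: "U \<subseteq> carrier G" using assms(1) by (rule subgroup.subset)
  have "normalizer (G\<lparr>carrier := U\<rparr>) K = {u \<in> U. conjugate (G\<lparr>carrier := U\<rparr>) u K = K}"
    using group.normalizer_eq[OF subgroup_imp_group[OF assms(1)], of K] assms(2) by simp
  then show ?thesis
    using assms U by (auto simp: normalizer_eq conjugate_carrier_update)
qed

lemma subset_normalizer:
  assumes "subgroup K G"
  shows "K \<subseteq> normalizer G K"
proof
  fix k assume k: "k \<in> K"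
  interpret K: subgroup K G by fact
  have "k <# K = K" "K #> inv k = K"
    using k assms coset_join2 coset_join3 by auto
  then show "k \<in> normalizer G K"
    using k by (simp add: normalizer_eq K.subset conjugate_def)
qed

lemma conjugacy_class_carrier_update:
  "subgroup U G \<Longrightarrow> conjugacy_class (G\<lparr>carrier := U\<rparr>) V = (\<lambda>u. conjugate G u V) ` U"
  by (simp add: conjugacy_class_eq conjugate_carrier_update)

text \<open>The fixed points of \<open>W = a K a\<^sup>-\<^sup>1\<close> on \<open>G/V\<close> of the given type are the \<open>a n u V\<close>
  with \<open>n \<in> N\<^sub>G(K)\<close> and \<open>u V\<close> a fixed point of \<open>K\<close> on \<open>U/V\<close>.\<close>

lemma card_fixed_points_over_class:
  assumes U: "subgroup U G" and V: "subgroup V G" "V \<subseteq> U" and K: "subgroup K G" "K \<subseteq> U"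
    and a: "a \<in> carrier G" and fin: "finite (rcosets V)" "finite (rcosets K)"
  shows "card ((\<lambda>g. g <# V) ` {g \<in> carrier G. conjugate G a K \<subseteq> conjugate G g V \<and>
      conjugate G (inv g) (conjugate G a K) \<in> conjugacy_class (G\<lparr>carrier := U\<rparr>) K})
    = normalizer_index G U K * mark (G\<lparr>carrier := U\<rparr>) K V" (is "card ?F = _")
proof -
  interpret U: subgroup U G by (rule U)
  interpret GU: group "G\<lparr>carrier := U\<rparr>" by (rule subgroup_imp_group[OF U])
  have cU: "U \<subseteq> carrier G" and cV: "V \<subseteq> carrier G" and cK: "K \<subseteq> carrier G"
    using U V K by (auto dest: subgroup.subset)
  define N where "N = normalizer G K"
  define M where "M = N \<inter> U"
  have N_eq: "N = {g \<in> carrier G. conjugate G g K = K}"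
    unfolding N_def by (rule normalizer_eq[OF cK])
  have N: "subgroup N G"
    unfolding N_def using cK by (rule normalizer_imp_subgroup)
  interpret N: subgroup N G by (rule N)
  interpret GN: group "G\<lparr>carrier := N\<rparr>" by (rule subgroup_imp_group[OF N])
  have M: "subgroup M G" unfolding M_def by (rule subgroups_Inter_pair[OF N U])
  have KM: "K \<subseteq> M" using subset_normalizer[OF K(1)] K(2) by (simp add: M_def N_def)
  define P where "P = {u \<in> U. K \<subseteq> conjugate G u V}"
  \<comment> \<open>The inverse of \<open>n\<close> appears because the index of \<open>M\<close> in
    \<open>N\<close> is counted by right cosets: (m n)^-1 u = n^-1 (m^-1 u), and m^-1 is absorbed
    into \<open>P\<close>.\<close>
  define A where "A n = (\<lambda>u. (a \<otimes> inv n \<otimes> u) <# V) ` P" for n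
  define R where "R = rcosets\<^bsub>G\<lparr>carrier := N\<rparr>\<^esub> M"
  have R: "R = (\<lambda>n. M #> n) ` N"
    unfolding R_def by (rule rcosets_carrier_update)
  \<comment> \<open>\<open>K\<close> lies in \<open>M\<close>, and its cosets in \<open>N\<close>
    are among its finitely many cosets in \<open>G\<close>.\<close>
  have finR: "finite R"
    unfolding R_def
  proof (rule GN.finite_rcosets_mono)
    show "subgroup K (G\<lparr>carrier := N\<rparr>)" "subgroup M (G\<lparr>carrier := N\<rparr>)"
      using K(1) M N KM by (auto simp: subgroup_subset_carrier_update M_def)
    have "rcosets\<^bsub>G\<lparr>carrier := N\<rparr>\<^esub> K \<subseteq> rcosets K"
      using N.subset by (auto simp: rcosets_carrier_update RCOSETS_def)
    then show "finite (rcosets\<^bsub>G\<lparr>carrier := N\<rparr>\<^esub> K)" using fin(2) finite_subset by blast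
  qed (rule KM)
  have N_D: "n \<in> carrier G" "conjugate G n K = K" if "n \<in> N" for n
    using that unfolding N_eq by blast+
  have M_D: "m \<in> N" "m \<in> U" if "m \<in> M" for m
    using that unfolding M_def by blast+
  have P_D: "u \<in> U" "u \<in> carrier G" "K \<subseteq> conjugate G u V" if "u \<in> P" for u
    using that cU unfolding P_def by blast+
  have P_M: "m \<otimes> u \<in> P" if "m \<in> M" "u \<in> P" for m u
  proof -
    have m: "m \<in> U" "m \<in> carrier G" "conjugate G m K = K" using M_D[OF that(1)] N_D by auto
    note u = P_D[OF that(2)]
    have "conjugate G m K \<subseteq> conjugate G m (conjugate G u V)"
      using u(3) by (rule conjugate_mono)
    then show ?thesis using m u cV by (simp add: conjugate_conjugate P_def)
  qed
  have A_subset: "A (m \<otimes> n) \<subseteq> A n" if "m \<in> M" "n \<in> N" for m n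
  proof
    have m: "m \<in> carrier G" "inv m \<in> M"
      using M_D[OF that(1)] N_D subgroup.m_inv_closed[OF M that(1)] by auto
    have n: "n \<in> carrier G" using that by simp
    fix C assume "C \<in> A (m \<otimes> n)"
    then obtain u where u: "u \<in> P" "C = (a \<otimes> inv (m \<otimes> n) \<otimes> u) <# V" by (auto simp: A_def)
    then have "C = (a \<otimes> inv n \<otimes> (inv m \<otimes> u)) <# V"
      using m n a P_D[OF u(1)] by (simp add: inv_mult_group m_assoc)
    then show "C \<in> A n" using P_M[OF m(2) u(1)] by (auto simp: A_def)
  qed
  have A_M: "A (m \<otimes> n) = A n" if "m \<in> M" "n \<in> N" for m n
  proof
    have m: "m \<in> carrier G" "m \<in> N" "inv m \<in> M"
      using M_D[OF that(1)] N_D subgroup.m_inv_closed[OF M that(1)] by auto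
    have "A (inv m \<otimes> (m \<otimes> n)) \<subseteq> A (m \<otimes> n)" using m that by (intro A_subset) auto
    then show "A n \<subseteq> A (m \<otimes> n)" using m that by (simp add: mult_inv_cancel_left)
  qed (rule A_subset[OF that])
  \<comment> \<open>If a n^-1 u V = a n'^-1 u' V, then u^-1 n n'^-1 u' lies in \<open>V\<close>,
    hence in \<open>U\<close>, and so does n n'^-1.\<close>
  have A_inter: "M #> n = M #> n'" if n_N: "n \<in> N" "n' \<in> N" and meet: "A n \<inter> A n' \<noteq> {}" for n n'
  proof -
    have n: "n \<in> carrier G" "n' \<in> carrier G" using n_N by auto
    obtain u u' where u: "u \<in> P" "u' \<in> P"
      "((a \<otimes> inv n' \<otimes> u') <# V) = ((a \<otimes> inv n \<otimes> u) <# V)"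
      using meet by (auto simp: A_def)
    then have uU: "u \<in> U" "u' \<in> U" "u \<in> carrier G" "u' \<in> carrier G" using P_D by auto
    have "inv (a \<otimes> inv n \<otimes> u) \<otimes> (a \<otimes> inv n' \<otimes> u') \<in> V"
      using u(3) uU n a by (simp add: l_coset_eq_iff[OF V(1)])
    then have "inv u \<otimes> (n \<otimes> inv n') \<otimes> u' \<in> U"
      using uU n a V(2) by (auto simp: inv_mult_group m_assoc mult_inv_cancel_left)
    then have "u \<otimes> (inv u \<otimes> (n \<otimes> inv n') \<otimes> u') \<otimes> inv u' \<in> U" using uU by blast
    then have "n \<otimes> inv n' \<in> U"
      using uU n by (simp add: m_assoc mult_inv_cancel_left)
    then have "n \<otimes> inv n' \<in> M" using n_N unfolding M_def by blast
    then show ?thesis using n by (simp add: r_coset_eq_iff[OF M])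
  qed
  have F_eq: "?F = (\<Union>n\<in>N. A n)"
  proof (intro equalityI subsetI)
    fix C assume "C \<in> ?F"
    then obtain g u where g: "g \<in> carrier G" "C = g <# V" "conjugate G a K \<subseteq> conjugate G g V"
      and u: "u \<in> U" "conjugate G (inv g) (conjugate G a K) = conjugate G u K"
      by (auto simp: conjugacy_class_carrier_update[OF U])
    have uc: "u \<in> carrier G" using u cU by auto
    \<comment> \<open>The solution of g = a n^-1 u^-1. It normalizes \<open>K\<close>: conjugation
      by n = u^-1 g^-1 a takes K to a K a^-1, then to u K u^-1, then back to K.\<close>
    define n where "n = inv (inv a \<otimes> g \<otimes> u)"
    have nc: "n \<in> carrier G" using g uc a by (simp add: n_def)
    have "n = inv u \<otimes> inv g \<otimes> a" using g(1) uc a by (simp add: n_def inv_mult_group m_assoc)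
    then have "conjugate G n K = conjugate G (inv u) (conjugate G (inv g) (conjugate G a K))"
      using g(1) uc a cK by (simp add: conjugate_conjugate conjugate_subset m_assoc)
    also have "\<dots> = K" unfolding u(2) using uc cK by simp
    finally have "n \<in> N" using nc unfolding N_eq by blast
    moreover have "C = (a \<otimes> inv n \<otimes> inv u) <# V"
      using g uc a by (simp add: n_def m_assoc mult_inv_cancel_left)
    moreover have "inv u \<in> P"
    proof -
      have "conjugate G u K \<subseteq> V"
        using g a cK cV by (simp add: u(2)[symmetric] subset_conjugate_iff conjugate_subset)
      then show ?thesis using u uc cK cV by (simp add: P_def subset_conjugate_iff)
    qed
    ultimately show "C \<in> (\<Union>n\<in>N. A n)" by (auto simp: A_def)
  next
    fix C assume "C \<in> (\<Union>n\<in>N. A n)"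
    then obtain n u where n: "n \<in> N" and u: "u \<in> P" and C: "C = (a \<otimes> inv n \<otimes> u) <# V"
      by (auto simp: A_def)
    note nc = N_D[OF n]
    have nc': "conjugate G (inv n) K = K" using conjugate_inv_cancel(1)[OF cK nc(1)] nc(2) by simp
    note uc = P_D[OF u]
    let ?g = "a \<otimes> inv n \<otimes> u"
    have "inv ?g \<otimes> a = inv u \<otimes> n"
      using a nc(1) uc by (simp add: inv_mult_group m_assoc)
    then have "conjugate G (inv ?g) (conjugate G a K) = conjugate G (inv u \<otimes> n) K"
      using a nc(1) uc cK by (simp add: conjugate_conjugate)
    also have "\<dots> = conjugate G (inv u) (conjugate G n K)"
      using nc(1) uc cK by (simp add: conjugate_conjugate)
    finally have eq: "conjugate G (inv ?g) (conjugate G a K) = conjugate G (inv u) K"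
      by (simp add: nc)
    then have "conjugate G a K \<subseteq> conjugate G ?g V"
      using a nc uc cK cV by (simp add: subset_conjugate_iff conjugate_subset)
    moreover have "conjugate G (inv ?g) (conjugate G a K) \<in> conjugacy_class (G\<lparr>carrier := U\<rparr>) K"
      using eq uc by (auto simp: conjugacy_class_carrier_update[OF U])
    ultimately show "C \<in> ?F" using C a nc uc by auto
  qed
  \<comment> \<open>Left translation by a n^-1 identifies the fixed points of \<open>K\<close> on
    U/V with \<open>A n\<close>, so the size does not depend on \<open>n\<close>.\<close>
  have card_A: "card (A n) = mark (G\<lparr>carrier := U\<rparr>) K V" if "n \<in> N" for n
  proof -
    have nc: "n \<in> carrier G" using that by simp
    have "subgroup V (G\<lparr>carrier := U\<rparr>)" using U V by (simp add: subgroup_subset_carrier_update)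
    from GU.fixed_points_lcosets[OF this, of K] K(2)
    have "mark (G\<lparr>carrier := U\<rparr>) K V = card ((\<lambda>u. u <# V) ` P)"
      using U by (simp add: mark_def P_def conjugate_carrier_update cong: conj_cong)
    moreover have "A n = (\<lambda>C. (a \<otimes> inv n) <# C) ` ((\<lambda>u. u <# V) ` P)"
      using nc a cU cV by (auto simp: A_def P_def image_image lcos_m_assoc subset_iff)
    moreover have "inj_on (\<lambda>C. (a \<otimes> inv n) <# C) ((\<lambda>u. u <# V) ` P)"
      by (rule inj_on_subset[OF inj_on_l_coset])
        (use a nc cU cV in \<open>auto simp: P_def l_coset_mem_iff subset_iff\<close>)
    ultimately show ?thesis by (simp add: card_image)
  qed
  \<comment> \<open>By \<open>A_M\<close>, \<open>A n\<close> depends only on the coset M n. Taking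
    the union over a coset indexes the family by \<open>R\<close> without choosing
    representatives.\<close>
  define B where "B D = (\<Union>n\<in>D. A n)" for D
  have B: "B (M #> n) = A n" if "n \<in> N" for n
    using that A_M one_closed subgroup.one_closed[OF M] by (force simp: B_def r_coset_def)
  have "card (\<Union>D\<in>R. B D) = (\<Sum>D\<in>R. card (B D))"
  proof (rule card_UN_disjoint[OF finR])
    have "A n \<subseteq> lcosets V" if n: "n \<in> N" for n
    proof
      fix C assume "C \<in> A n"
      then obtain u where u: "u \<in> P" "C = (a \<otimes> inv n \<otimes> u) <# V" by (auto simp: A_def)
      have "a \<otimes> inv n \<otimes> u \<in> carrier G" using a n P_D[OF u(1)] by simp
      then show "C \<in> lcosets V" using u(2) by (auto simp: LCOSETS_def)
    qed
    then show "\<forall>D\<in>R. finite (B D)"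
      using finite_lcosets[OF V(1) fin(1)] finite_subset by (fastforce simp: R B)
    show "\<forall>D\<in>R. \<forall>D'\<in>R. D \<noteq> D' \<longrightarrow> B D \<inter> B D' = {}"
      using A_inter by (auto simp: R B)
  qed
  moreover have "?F = (\<Union>D\<in>R. B D)" unfolding F_eq by (auto simp: R B)
  moreover have "(\<Sum>D\<in>R. card (B D)) = (\<Sum>D\<in>R. mark (G\<lparr>carrier := U\<rparr>) K V)"
    by (rule sum.cong) (auto simp: R B card_A)
  moreover have "normalizer_index G U K = card R"
    by (simp add: normalizer_index_def group_index_def normalizer_carrier_update[OF U K(2)]
        R_def M_def N_def)
  ultimately show ?thesis by simp
qed

text \<open>For a fixed point g V, the group g^-1 W g lies in \<open>V\<close> and so in
  \<open>U\<close>. Its class in \<open>U\<close> does not depend on \<open>g\<close>, because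
  another choice differs by an element of \<open>V\<close>. The fixed points thus split into
  disjoint families, each of the size given by \<open>card_fixed_points_over_class\<close>.\<close>

lemma mark_eq_sum_normalizer_index:
  assumes U: "subgroup U G" and V: "subgroup V G" "V \<subseteq> U" and W: "subgroup W G"
    and fin: "finite (rcosets V)" "finite (rcosets W)"
    and S: "finite S" "S = conjugacy_class (G\<lparr>carrier := U\<rparr>) ` {K. K \<subseteq> U \<and> K \<in> conjugacy_class G W}"
  shows "mark G W V =
    (\<Sum>f\<in>S. normalizer_index G U (rep f) * mark (G\<lparr>carrier := U\<rparr>) (rep f) V)"
proof -
  interpret U: subgroup U G by (rule U)
  interpret GU: group "G\<lparr>carrier := U\<rparr>" by (rule subgroup_imp_group[OF U])
  have cU: "U \<subseteq> carrier G" and cV: "V \<subseteq> carrier G" and cW: "W \<subseteq> carrier G"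
    using U V W by (auto dest: subgroup.subset)
  let ?C = "conjugacy_class (G\<lparr>carrier := U\<rparr>)"
  have cl: "?C L = ?C K \<and> L \<subseteq> U" if L: "L \<in> ?C K" "K \<subseteq> U" for L K
  proof -
    obtain u where "u \<in> U" "L = conjugate (G\<lparr>carrier := U\<rparr>) u K"
      using L(1) unfolding conjugacy_class_eq by auto
    then show ?thesis
      using GU.conjugacy_class_conjugate[of K u] GU.conjugate_subset[of K u] L(2) by simp
  qed
  define F where "F f = (\<lambda>g. g <# V) ` {g \<in> carrier G. W \<subseteq> conjugate G g V \<and>
    conjugate G (inv g) W \<in> f}" for f
  have card_F: "card (F f) = normalizer_index G U (rep f) * mark (G\<lparr>carrier := U\<rparr>) (rep f) V"
    if f: "f \<in> S" for f
  proof -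
    obtain K where K: "K \<subseteq> U" "K \<in> conjugacy_class G W" "f = ?C K" using f unfolding S(2) by blast
    obtain u where u: "u \<in> U" "rep f = conjugate (G\<lparr>carrier := U\<rparr>) u K"
      using GU.rep_conjugacy_class[of K] K by auto
    obtain b where b: "b \<in> carrier G" "K = conjugate G b W" using K by (auto simp: conjugacy_class_eq)
    have uc: "u \<in> carrier G" using u cU by auto
    \<comment> \<open>\<open>rep f\<close> is (u b) W (u b)^-1, so the inverse of u b carries it
      back to \<open>W\<close>.\<close>
    define a where "a = inv (u \<otimes> b)"
    have a: "a \<in> carrier G" using uc b by (simp add: a_def)
    have rep: "rep f = conjugate G (u \<otimes> b) W"
      using u b cW uc by (simp add: conjugate_carrier_update[OF U] conjugate_conjugate)
    then have Wa: "W = conjugate G a (rep f)"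
      using uc b cW by (simp add: a_def)
    have "f = ?C (rep f)"
      using GU.conjugacy_class_conjugate[of K u] K u by simp
    moreover have sub: "rep f \<subseteq> U"
      using GU.conjugate_subset[of K u] K u by simp
    moreover have sg: "subgroup (rep f) G" using rep subgroup_conjugate[OF W] uc b by simp
    moreover have "finite (rcosets (rep f))"
    proof -
      \<comment> \<open>An infinite coset space would have \<open>card\<close> 0, so equality with a
        positive index transfers finiteness.\<close>
      have "group_index G (rep f) = group_index G W" using rep group_index_conjugate[OF W] uc b by simp
      moreover have "group_index G W > 0"
        using fin(2) rcosetsI[OF cW one_closed] by (auto simp: group_index_def card_gt_0_iff)
      ultimately show ?thesis by (auto simp: group_index_def card_gt_0_iff)
    qed
    ultimately show ?thesis
      using card_fixed_points_over_class[OF U V sg sub a fin(1)] Wa by (simp add: F_def)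
  qed
  have "fixed_points (lcosets V) (\<lambda>g C. g <# C) W = (\<Union>f\<in>S. F f)"
  proof -
    have "\<exists>f\<in>S. conjugate G (inv g) W \<in> f" if g: "g \<in> carrier G" "W \<subseteq> conjugate G g V" for g
    proof -
      have "conjugate G (inv g) W \<subseteq> U" using g cV cW V by (auto simp: subset_conjugate_iff)
      moreover have "conjugate G (inv g) W \<in> conjugacy_class G W"
        using g by (auto simp: conjugacy_class_eq)
      ultimately show ?thesis
        unfolding S(2) using GU.mem_conjugacy_class_self[of "conjugate G (inv g) W"] by auto
    qed
    then show ?thesis
      unfolding fixed_points_lcosets[OF V(1) cW]
      by (intro equalityI subsetI) (fastforce simp: F_def)+
  qed
  moreover have "card (\<Union>f\<in>S. F f) = (\<Sum>f\<in>S. card (F f))"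
  proof (rule card_UN_disjoint[OF S(1)])
    have "F f \<subseteq> lcosets V" for f by (auto simp: F_def LCOSETS_def)
    then show "\<forall>f\<in>S. finite (F f)" using finite_lcosets[OF V(1) fin(1)] finite_subset by blast
    have "f = f'" if f: "f \<in> S" "f' \<in> S" and C: "C \<in> F f" "C \<in> F f'" for f f' C
    proof -
      obtain K K' where K: "K \<subseteq> U" "f = ?C K" "K' \<subseteq> U" "f' = ?C K'" using f unfolding S(2) by blast
      obtain g g' where g: "g \<in> carrier G" "g' \<in> carrier G" "(g <# V) = (g' <# V)"
        "conjugate G (inv g) W \<in> ?C K" "conjugate G (inv g') W \<in> ?C K'"
        using C K by (auto simp: F_def)
      then have "inv g' \<otimes> g \<in> U" using V by (auto simp: l_coset_eq_iff)
      moreover have "conjugate G (inv g') W = conjugate G (inv g' \<otimes> g) (conjugate G (inv g) W)"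
        using g cW by (simp add: conjugate_conjugate m_assoc)
      moreover have "?C (conjugate G (inv g) W) = ?C K" "?C (conjugate G (inv g') W) = ?C K'"
        "conjugate G (inv g) W \<subseteq> U"
        using cl[OF g(4) K(1)] cl[OF g(5) K(3)] by auto
      ultimately show ?thesis
        using GU.conjugacy_class_conjugate[of "conjugate G (inv g) W" "inv g' \<otimes> g"] K
        by (simp add: conjugate_carrier_update[OF U])
    qed
    then show "\<forall>f\<in>S. \<forall>f'\<in>S. f \<noteq> f' \<longrightarrow> F f \<inter> F f' = {}" by blast
  qed
  ultimately show ?thesis by (simp add: mark_def card_F)
qed

end

section \<open>Additivity of the Adams operations\<close>

lemma (in abelian_monoid) finsum_swap:
  assumes "finite I" "finite J" "\<And>i j. i \<in> I \<Longrightarrow> j \<in> J \<Longrightarrow> f i j \<in> carrier G"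
  shows "(\<Oplus>i\<in>I. \<Oplus>j\<in>J. f i j) = (\<Oplus>j\<in>J. \<Oplus>i\<in>I. f i j)"
  using assms(1,3)
proof (induction I)
  case (insert i I)
  have "(\<Oplus>j\<in>J. \<Oplus>i\<in>insert i I. f i j) = (\<Oplus>j\<in>J. f i j \<oplus> (\<Oplus>i\<in>I. f i j))"
    using insert by (intro finsum_cong') (auto simp: Pi_def intro!: finsum_closed)
  also have "\<dots> = (\<Oplus>j\<in>J. f i j) \<oplus> (\<Oplus>j\<in>J. \<Oplus>i\<in>I. f i j)"
    using insert by (intro finsum_addf) (auto simp: Pi_def intro!: finsum_closed)
  finally show ?case
    using insert by (simp add: Pi_def finsum_closed)
qed simp

lemma (in abelian_monoid) add_pow_finsum:
  assumes "f \<in> I \<rightarrow> carrier G"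
  shows "[(k::nat)] \<cdot> (\<Oplus>i\<in>I. f i) = (\<Oplus>i\<in>I. [k] \<cdot> f i)"
  using assms
proof (induction I rule: infinite_finite_induct)
  case (insert i I)
  then show ?case by (simp add: Pi_def add.nat_pow_distrib)
qed simp_all

section \<open>Power series as coefficient functions, and the logarithmic derivative\<close>

definition cauchy_prod :: "('a, 'b) ring_scheme \<Rightarrow> (nat \<Rightarrow> 'a) \<Rightarrow> (nat \<Rightarrow> 'a) \<Rightarrow> nat \<Rightarrow> 'a"
  where "cauchy_prod R f g n = (\<Oplus>\<^bsub>R\<^esub>i\<in>{..n}. f i \<otimes>\<^bsub>R\<^esub> g (n - i))"

definition series_trunc :: "('a, 'b) ring_scheme \<Rightarrow> nat \<Rightarrow> (nat \<Rightarrow> 'a) \<Rightarrow> nat \<Rightarrow> 'a"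
  where "series_trunc R n f = (\<lambda>i. if i \<le> n then f i else \<zero>\<^bsub>R\<^esub>)"

definition series_deriv :: "('a, 'b) ring_scheme \<Rightarrow> (nat \<Rightarrow> 'a) \<Rightarrow> nat \<Rightarrow> 'a"
  where "series_deriv R f n = [Suc n] \<cdot>\<^bsub>R\<^esub> f (Suc n)"

context cring
begin

lemma cauchy_prod_closed [simp, intro]:
  "f \<in> UNIV \<rightarrow> carrier R \<Longrightarrow> g \<in> UNIV \<rightarrow> carrier R \<Longrightarrow> cauchy_prod R f g n \<in> carrier R"
  by (auto simp: cauchy_prod_def Pi_iff intro!: finsum_closed)

lemma range_cauchy_prod:
  "f \<in> UNIV \<rightarrow> carrier R \<Longrightarrow> g \<in> UNIV \<rightarrow> carrier R \<Longrightarrow> (cauchy_prod R f g) \<in> UNIV \<rightarrow> carrier R"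
  by auto

text \<open>Commutativity and associativity are inherited from \<open>UP R\<close>, since the \<open>n\<close>-th coefficient
  of a product only depends on the factors truncated at \<open>n\<close>.\<close>

lemma series_trunc_in_UP:
  assumes "f \<in> UNIV \<rightarrow> carrier R"
  shows "series_trunc R n f \<in> carrier (UP R)"
proof -
  have "series_trunc R n f i \<in> carrier R" for i
    using assms by (auto simp: series_trunc_def)
  moreover have "bound \<zero> n (series_trunc R n f)"
    by (rule bound.intro) (simp add: series_trunc_def)
  ultimately show ?thesis by (auto simp: UP_def intro!: mem_upI)
qed

lemma UP_mult_eq:
  "p \<in> carrier (UP R) \<Longrightarrow> r \<in> carrier (UP R) \<Longrightarrow> p \<otimes>\<^bsub>UP R\<^esub> r = cauchy_prod R p r"
  by (auto simp: UP_def cauchy_prod_def)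

lemma cauchy_prod_trunc:
  assumes "f \<in> UNIV \<rightarrow> carrier R" "g \<in> UNIV \<rightarrow> carrier R" "\<And>i. i \<le> n \<Longrightarrow> f' i = f i"
    "\<And>i. i \<le> n \<Longrightarrow> g' i = g i"
  shows "cauchy_prod R f' g' n = cauchy_prod R f g n"
  unfolding cauchy_prod_def by (rule finsum_cong') (use assms in \<open>auto simp: Pi_iff\<close>)

lemma cauchy_prod_comm:
  assumes "f \<in> UNIV \<rightarrow> carrier R" "g \<in> UNIV \<rightarrow> carrier R"
  shows "cauchy_prod R f g = cauchy_prod R g f"
proof
  fix n
  interpret UP: UP_cring R "UP R" by unfold_locales
  note t = series_trunc_in_UP[OF assms(1), of n] series_trunc_in_UP[OF assms(2), of n]
  have "cauchy_prod R f g n = (series_trunc R n f \<otimes>\<^bsub>UP R\<^esub> series_trunc R n g) n"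
    unfolding UP_mult_eq[OF t]
    by (rule cauchy_prod_trunc[symmetric]) (use assms in \<open>auto simp: series_trunc_def\<close>)
  also have "series_trunc R n f \<otimes>\<^bsub>UP R\<^esub> series_trunc R n g = series_trunc R n g \<otimes>\<^bsub>UP R\<^esub> series_trunc R n f"
    using t by (rule UP.UP_m_comm)
  also have "\<dots> n = cauchy_prod R g f n"
    unfolding UP_mult_eq[OF t(2,1)]
    by (rule cauchy_prod_trunc) (use assms in \<open>auto simp: series_trunc_def\<close>)
  finally show "cauchy_prod R f g n = cauchy_prod R g f n" .
qed

lemma cauchy_prod_assoc:
  assumes "f \<in> UNIV \<rightarrow> carrier R" "g \<in> UNIV \<rightarrow> carrier R" "h \<in> UNIV \<rightarrow> carrier R"
  shows "cauchy_prod R (cauchy_prod R f g) h = cauchy_prod R f (cauchy_prod R g h)"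
proof
  fix n
  interpret UP: UP_cring R "UP R" by unfold_locales
  note t = series_trunc_in_UP[OF assms(1), of n] series_trunc_in_UP[OF assms(2), of n] series_trunc_in_UP[OF assms(3), of n]
  have tr: "series_trunc R n a i = a i" if "i \<le> n" for a i
    using that by (simp add: series_trunc_def)
  have eq: "cauchy_prod R (series_trunc R n a) (series_trunc R n b) i = cauchy_prod R a b i"
    if "i \<le> n" "a \<in> UNIV \<rightarrow> carrier R" "b \<in> UNIV \<rightarrow> carrier R" for a b i
    by (rule cauchy_prod_trunc) (use that in \<open>auto simp: series_trunc_def\<close>)
  have "cauchy_prod R (cauchy_prod R f g) h n =
    cauchy_prod R (cauchy_prod R (series_trunc R n f) (series_trunc R n g)) (series_trunc R n h) n"
    by (rule cauchy_prod_trunc[symmetric])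
      (use assms in \<open>auto simp: eq tr\<close>)
  also have "\<dots> = ((series_trunc R n f \<otimes>\<^bsub>UP R\<^esub> series_trunc R n g) \<otimes>\<^bsub>UP R\<^esub> series_trunc R n h) n"
    using t UP.UP_ring by (simp add: UP_mult_eq ring.ring_simprules(5) flip: UP_mult_eq)
  also have "\<dots> = (series_trunc R n f \<otimes>\<^bsub>UP R\<^esub> (series_trunc R n g \<otimes>\<^bsub>UP R\<^esub> series_trunc R n h)) n"
    using t by (simp add: UP.UP_m_assoc)
  also have "\<dots> = cauchy_prod R (series_trunc R n f) (cauchy_prod R (series_trunc R n g) (series_trunc R n h)) n"
    using t UP.UP_ring by (simp add: UP_mult_eq ring.ring_simprules(5) flip: UP_mult_eq)
  also have "\<dots> = cauchy_prod R f (cauchy_prod R g h) n"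
    by (rule cauchy_prod_trunc) (use assms in \<open>auto simp: eq tr\<close>)
  finally show "cauchy_prod R (cauchy_prod R f g) h n = cauchy_prod R f (cauchy_prod R g h) n" .
qed

lemma cauchy_prod_add_left:
  assumes "f \<in> UNIV \<rightarrow> carrier R" "g \<in> UNIV \<rightarrow> carrier R" "h \<in> UNIV \<rightarrow> carrier R"
  shows "cauchy_prod R h (\<lambda>i. f i \<oplus> g i) n = cauchy_prod R h f n \<oplus> cauchy_prod R h g n"
proof -
  have c: "f i \<in> carrier R" "g i \<in> carrier R" "h i \<in> carrier R" for i using assms by auto
  show ?thesis
    unfolding cauchy_prod_def by (simp add: c r_distr Pi_def finsum_addf)
qed

text \<open>Leibniz rule. The factor n+1 of the term f_i g_(n+1-i) is split as i + (n+1-i); the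
  summand i = 0 of the first part and the summand i = n+1 of the second vanish, which brings both
  sums to the range \<open>{..n}\<close>.\<close>

lemma series_deriv_cauchy_prod:
  assumes "f \<in> UNIV \<rightarrow> carrier R" "g \<in> UNIV \<rightarrow> carrier R"
  shows "series_deriv R (cauchy_prod R f g) n =
    cauchy_prod R (series_deriv R f) g n \<oplus> cauchy_prod R f (series_deriv R g) n"
proof -
  have c: "f i \<in> carrier R" "g i \<in> carrier R" for i using assms by auto
  have "series_deriv R (cauchy_prod R f g) n =
    (\<Oplus>i\<in>{..Suc n}. [Suc n] \<cdot> (f i \<otimes> g (Suc n - i)))"
    unfolding series_deriv_def cauchy_prod_def using c by (intro add_pow_finsum) auto
  also have "\<dots> = (\<Oplus>i\<in>{..Suc n}. [i] \<cdot> (f i \<otimes> g (Suc n - i)) \<oplus> [(Suc n - i)] \<cdot> (f i \<otimes> g (Suc n - i)))"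
    using c by (intro finsum_cong') (auto simp: add.nat_pow_mult)
  also have "\<dots> = (\<Oplus>i\<in>{..Suc n}. [i] \<cdot> (f i \<otimes> g (Suc n - i))) \<oplus>
     (\<Oplus>i\<in>{..Suc n}. [(Suc n - i)] \<cdot> (f i \<otimes> g (Suc n - i)))"
    using c by (intro finsum_addf) auto
  also have "(\<Oplus>i\<in>{..Suc n}. [i] \<cdot> (f i \<otimes> g (Suc n - i))) =
    (\<Oplus>i\<in>{..n}. [Suc i] \<cdot> (f (Suc i) \<otimes> g (n - i)))"
    using c by (subst finsum_Suc2) (auto simp: Pi_def)
  also have "\<dots> = cauchy_prod R (series_deriv R f) g n"
    unfolding cauchy_prod_def series_deriv_def
    using c by (intro finsum_cong') (auto simp: add_pow_ldistr simp del: add.nat_pow_Suc)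
  also have "(\<Oplus>i\<in>{..Suc n}. [(Suc n - i)] \<cdot> (f i \<otimes> g (Suc n - i))) =
     (\<Oplus>i\<in>{..n}. [(Suc n - i)] \<cdot> (f i \<otimes> g (Suc n - i)))"
    using c by (subst finsum_Suc) (auto simp: Pi_def)
  also have "\<dots> = cauchy_prod R f (series_deriv R g) n"
    unfolding cauchy_prod_def series_deriv_def
    using c by (intro finsum_cong') (auto simp: add_pow_rdistr Suc_diff_le simp del: add.nat_pow_Suc)
  finally show ?thesis .
qed

text \<open>Isolates the only summand that contains \<open>g n\<close>, so an equation for the
  product becomes a recursion for \<open>g\<close>.\<close>

lemma cauchy_prod_constant_term_one:
  assumes "g \<in> UNIV \<rightarrow> carrier R" "f \<in> UNIV \<rightarrow> carrier R" "f 0 = \<one>"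
  shows "cauchy_prod R f g n = g n \<oplus> (\<Oplus>i\<in>{1..n}. f i \<otimes> g (n - i))"
proof -
  have c: "f i \<in> carrier R" "g i \<in> carrier R" for i using assms by auto
  have "{..n} = insert 0 {1..n}" by auto
  then show ?thesis
    using c assms(3) by (simp add: cauchy_prod_def Pi_def)
qed

lemma log_deriv_ex1:
  assumes f: "f \<in> UNIV \<rightarrow> carrier R" "f 0 = \<one>"
  shows "\<exists>!g. (\<forall>n. g n \<in> carrier R) \<and>
    (\<forall>n. [Suc n] \<cdot> f (Suc n) = (\<Oplus>i\<in>{..n}. f i \<otimes> g (n - i)))"
proof (rule ex_ex1I)
  have c: "f i \<in> carrier R" for i using assms by auto
  define P where "P g n r \<longleftrightarrow> r \<in> carrier R \<and> ((\<forall>k<n. g k \<in> carrier R) \<longrightarrow>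
    [Suc n] \<cdot> f (Suc n) = r \<oplus> (\<Oplus>i\<in>{1..n}. f i \<otimes> g (n - i)))" for g n r
  have "\<exists>g. \<forall>n. P g n (g n)"
  proof (rule dependent_wellorder_choice)
    fix r and g h :: "nat \<Rightarrow> 'a" and n :: nat
    assume gh: "\<And>k. k < n \<Longrightarrow> g k = h k"
    have "(\<Oplus>i\<in>{1..n}. f i \<otimes> g (n - i)) = (\<Oplus>i\<in>{1..n}. f i \<otimes> h (n - i))"
      if "\<forall>k<n. h k \<in> carrier R"
      using that c by (intro finsum_cong') (auto simp: gh)
    then show "P g n r = P h n r" using gh by (auto simp: P_def)
  next
    fix n and g :: "nat \<Rightarrow> 'a"
    assume "\<And>k. k < n \<Longrightarrow> P g k (g k)"
    then have g: "\<forall>k<n. g k \<in> carrier R" by (simp add: P_def)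
    then have s: "(\<Oplus>i\<in>{1..n}. f i \<otimes> g (n - i)) \<in> carrier R" using c by (intro finsum_closed) auto
    then have "P g n ([Suc n] \<cdot> f (Suc n) \<ominus> (\<Oplus>i\<in>{1..n}. f i \<otimes> g (n - i)))"
      using c by (auto simp: P_def a_minus_def a_assoc l_neg)
    then show "\<exists>r. P g n r" by blast
  qed
  then obtain g where g: "\<And>n. P g n (g n)" by blast
  then have gc: "g \<in> UNIV \<rightarrow> carrier R" by (auto simp: P_def)
  then have "[Suc n] \<cdot> f (Suc n) = cauchy_prod R f g n" for n
    using g[of n] by (subst cauchy_prod_constant_term_one[OF gc f]) (auto simp: P_def)
  then show "\<exists>g. (\<forall>n. g n \<in> carrier R) \<and>
    (\<forall>n. [Suc n] \<cdot> f (Suc n) = (\<Oplus>i\<in>{..n}. f i \<otimes> g (n - i)))"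
    using gc unfolding cauchy_prod_def by blast
next
  have c: "f i \<in> carrier R" for i using assms by auto
  fix g h
  assume "(\<forall>n. g n \<in> carrier R) \<and> (\<forall>n. [Suc n] \<cdot> f (Suc n) = (\<Oplus>i\<in>{..n}. f i \<otimes> g (n - i)))"
    and "(\<forall>n. h n \<in> carrier R) \<and> (\<forall>n. [Suc n] \<cdot> f (Suc n) = (\<Oplus>i\<in>{..n}. f i \<otimes> h (n - i)))"
  then have gc: "g \<in> UNIV \<rightarrow> carrier R" and hc: "h \<in> UNIV \<rightarrow> carrier R"
    and eq: "cauchy_prod R f g n = cauchy_prod R f h n" for n
    by (auto simp: cauchy_prod_def)
  have "g n = h n" for n
  proof (induction n rule: less_induct)
    case (less n)
    have s: "(\<Oplus>i\<in>{1..n}. f i \<otimes> g (n - i)) = (\<Oplus>i\<in>{1..n}. f i \<otimes> h (n - i))"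
      using c hc by (intro finsum_cong') (auto simp: less)
    have sc: "(\<Oplus>i\<in>{1..n}. f i \<otimes> h (n - i)) \<in> carrier R"
      using c hc by (intro finsum_closed) auto
    have "g n \<in> carrier R" "h n \<in> carrier R" using gc hc by auto
    then show ?case
      using eq[of n] sc unfolding cauchy_prod_constant_term_one[OF gc f] cauchy_prod_constant_term_one[OF hc f] s
      by simp
  qed
  then show "g = h" ..
qed

lemma log_deriv_props:
  assumes f: "f \<in> UNIV \<rightarrow> carrier R" "f 0 = \<one>"
  shows "(log_deriv R f) \<in> UNIV \<rightarrow> carrier R" "series_deriv R f = cauchy_prod R f (log_deriv R f)"
proof -
  have *: "(\<forall>n. log_deriv R f n \<in> carrier R) \<and>
    (\<forall>n. [Suc n] \<cdot> f (Suc n) = (\<Oplus>i\<in>{..n}. f i \<otimes> log_deriv R f (n - i)))"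
    unfolding log_deriv_def by (rule theI'[OF log_deriv_ex1[OF f]])
  from * show "log_deriv R f \<in> UNIV \<rightarrow> carrier R" by blast
  from * show "series_deriv R f = cauchy_prod R f (log_deriv R f)"
    unfolding series_deriv_def cauchy_prod_def fun_eq_iff by blast
qed

lemma log_deriv_eqI:
  assumes f: "f \<in> UNIV \<rightarrow> carrier R" "f 0 = \<one>"
    and g: "g \<in> UNIV \<rightarrow> carrier R" "series_deriv R f = cauchy_prod R f g"
  shows "log_deriv R f = g"
proof -
  have "(\<forall>n. g n \<in> carrier R) \<and>
    (\<forall>n. [Suc n] \<cdot> f (Suc n) = (\<Oplus>i\<in>{..n}. f i \<otimes> g (n - i)))"
    using g unfolding series_deriv_def cauchy_prod_def fun_eq_iff by blast
  then show ?thesis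
    unfolding log_deriv_def by (rule the1_equality[OF log_deriv_ex1[OF f]])
qed

text \<open>With f' = f F and g' = g G, the Leibniz rule gives (f g)' = (f F) g + f (g G) = (f g)(F
  + G), and uniqueness of the logarithmic derivative identifies F + G.\<close>

lemma log_deriv_cauchy_prod:
  assumes f: "f \<in> UNIV \<rightarrow> carrier R" "f 0 = \<one>" and g: "g \<in> UNIV \<rightarrow> carrier R" "g 0 = \<one>"
  shows "log_deriv R (cauchy_prod R f g) = (\<lambda>n. log_deriv R f n \<oplus> log_deriv R g n)"
proof (rule log_deriv_eqI)
  note F = log_deriv_props[OF f] and G = log_deriv_props[OF g]
  let ?F = "log_deriv R f" and ?G = "log_deriv R g" and ?c = "cauchy_prod R"
  show "(?c f g) \<in> UNIV \<rightarrow> carrier R" using f g by (intro range_cauchy_prod)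
  show "?c f g 0 = \<one>" using f g by (simp add: cauchy_prod_def)
  show "(\<lambda>n. ?F n \<oplus> ?G n) \<in> UNIV \<rightarrow> carrier R" using F(1) G(1) by auto
  show "series_deriv R (?c f g) = ?c (?c f g) (\<lambda>n. ?F n \<oplus> ?G n)"
  proof
    fix n
    have "?c (?c f ?F) g = ?c f (?c ?F g)" using f g F(1) by (intro cauchy_prod_assoc)
    also have "?c ?F g = ?c g ?F" using g F(1) by (intro cauchy_prod_comm)
    also have "?c f (?c g ?F) = ?c (?c f g) ?F" using f g F(1) by (intro cauchy_prod_assoc[symmetric])
    finally have 1: "?c (?c f ?F) g = ?c (?c f g) ?F" .
    have 2: "?c f (?c g ?G) = ?c (?c f g) ?G" using f g G(1) by (intro cauchy_prod_assoc[symmetric])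
    show "series_deriv R (?c f g) n = ?c (?c f g) (\<lambda>n. ?F n \<oplus> ?G n) n"
      using f g F(1) G(1)
      by (simp add: series_deriv_cauchy_prod F(2) G(2) 1 2 cauchy_prod_add_left range_cauchy_prod)
  qed
qed

end

section \<open>Adams operations\<close>

context lambda_ring
begin

lemma lam_series: "x \<in> carrier R \<Longrightarrow> (\<lambda>i. lam i x) \<in> UNIV \<rightarrow> carrier R"
  by (auto intro: lam_closed)

lemma adams_closed: "x \<in> carrier R \<Longrightarrow> adams R lam n x \<in> carrier R"
  using log_deriv_props(1)[OF lam_series lam_0] by (simp add: adams_def Pi_iff)

text \<open>Coefficient 0 of the defining identity reads \<open>lam 1 x\<close> =
  \<open>lam 0 x\<close> times the constant term of the logarithmic derivative, and
  \<open>lam 0 x\<close> is one. It serves for the diagonal terms of the ghost map.\<close>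

lemma adams_1:
  assumes "x \<in> carrier R"
  shows "adams R lam 1 x = x"
proof -
  note p = log_deriv_props[OF lam_series[OF assms] lam_0[OF assms]]
  have c: "log_deriv R (\<lambda>i. lam i x) 0 \<in> carrier R" using p(1) by auto
  have "series_deriv R (\<lambda>i. lam i x) 0 = cauchy_prod R (\<lambda>i. lam i x) (log_deriv R (\<lambda>i. lam i x)) 0"
    using p(2) by simp
  then show ?thesis
    using c assms lam_0 lam_1 by (simp add: series_deriv_def cauchy_prod_def adams_def)
qed

text \<open>The axiom \<open>lam_add\<close> says that the lambda series of a sum is the product of
  the lambda series; the logarithmic derivative turns this product into a sum.\<close>

lemma adams_add:
  assumes "x \<in> carrier R" "y \<in> carrier R"
  shows "adams R lam n (x \<oplus> y) = adams R lam n x \<oplus> adams R lam n y"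
proof -
  have "(\<lambda>i. lam i (x \<oplus> y)) = cauchy_prod R (\<lambda>i. lam i x) (\<lambda>i. lam i y)"
    using assms by (simp add: lam_add cauchy_prod_def fun_eq_iff)
  then have "log_deriv R (\<lambda>i. lam i (x \<oplus> y)) =
    (\<lambda>n. log_deriv R (\<lambda>i. lam i x) n \<oplus> log_deriv R (\<lambda>i. lam i y) n)"
    using assms by (simp add: log_deriv_cauchy_prod lam_series lam_0)
  moreover have "log_deriv R (\<lambda>i. lam i x) k \<in> carrier R" "log_deriv R (\<lambda>i. lam i y) k \<in> carrier R" for k
    using log_deriv_props(1)[OF lam_series lam_0] assms by auto
  ultimately show ?thesis
    by (simp add: adams_def add.int_pow_distrib)
qed

lemma adams_zero: "adams R lam n \<zero> = \<zero>"
  using adams_add[of \<zero> \<zero> n] adams_closed[of \<zero> n] by simp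

lemma adams_finsum:
  assumes "f \<in> I \<rightarrow> carrier R"
  shows "adams R lam n (\<Oplus>i\<in>I. f i) = (\<Oplus>i\<in>I. adams R lam n (f i))"
  using assms
proof (induction I rule: infinite_finite_induct)
  case (insert i I)
  then show ?case by (simp add: Pi_def adams_add adams_closed)
qed (simp_all add: adams_zero)

end

text \<open>The multiple [n] x equals the scalar multiple of \<open>x\<close> by the rational n,
  which 1/n undoes. It allows the diagonal marks of the ghost map to be cancelled.\<close>

lemma rat_algebra_torsion_free:
  fixes A :: "(rat, 'a, 'b) module_scheme" (structure)
  assumes "algebra (ring_of_type_algebra :: rat ring) A"
    and x: "x \<in> carrier A" and "n > 0" "[(n::nat)] \<cdot> x = \<zero>"
  shows "x = \<zero>"
proof -
  interpret algebra "ring_of_type_algebra :: rat ring" A by fact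
  have Q: "carrier (ring_of_type_algebra :: rat ring) = UNIV"
    "(\<otimes>\<^bsub>ring_of_type_algebra\<^esub>) = ((*) :: rat \<Rightarrow> _)"
    "(\<oplus>\<^bsub>ring_of_type_algebra\<^esub>) = ((+) :: rat \<Rightarrow> _)"
    "\<one>\<^bsub>ring_of_type_algebra\<^esub> = (1 :: rat)" "\<zero>\<^bsub>ring_of_type_algebra\<^esub> = (0 :: rat)"
    by (simp_all add: ring_of_type_algebra_def)
  have nat: "of_nat k \<odot>\<^bsub>A\<^esub> x = [k] \<cdot> x" for k
  proof (induction k)
    case 0
    then show ?case using smult_l_null[OF x] by (simp add: Q)
  next
    case (Suc k)
    have "(of_nat k + 1) \<odot>\<^bsub>A\<^esub> x = of_nat k \<odot>\<^bsub>A\<^esub> x \<oplus> 1 \<odot>\<^bsub>A\<^esub> x"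
      using smult_l_distr[of "of_nat k" 1 x] x by (simp add: Q)
    moreover have "1 \<odot>\<^bsub>A\<^esub> x = x" using smult_one[OF x] by (simp add: Q)
    ultimately show ?case using Suc by (simp add: add.commute)
  qed
  have "x = (1 / of_nat n * of_nat n) \<odot>\<^bsub>A\<^esub> x"
    using smult_one[OF x] \<open>n > 0\<close> by (simp add: Q)
  also have "\<dots> = (1 / of_nat n) \<odot>\<^bsub>A\<^esub> (of_nat n \<odot>\<^bsub>A\<^esub> x)"
    using smult_assoc1[of "1 / of_nat n" "of_nat n" x] x by (simp add: Q)
  also have "\<dots> = \<zero>"
    using smult_r_null[of "1 / of_nat n"] by (simp add: nat assms(4) Q)
  finally show ?thesis .
qed

section \<open>Open subgroups of profinite groups\<close>

context group
begin

lemma group_index_pos: "subgroup V G \<Longrightarrow> finite (rcosets V) \<Longrightarrow> group_index G V > 0"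
  using rcosetsI[OF subgroup.subset one_closed] by (auto simp: group_index_def card_gt_0_iff)

text \<open>For u in \<open>U\<close> outside \<open>W\<close>, the cosets W and W u are distinct,
  so the factor (U : W) of (G : W) is at least 2. Induction on the index in the injectivity proof
  rests on this.\<close>

lemma group_index_strict_mono:
  assumes "subgroup W G" "subgroup U G" "W \<subset> U" "finite (rcosets W)"
  shows "group_index G U < group_index G W"
proof -
  have sub: "W \<subseteq> U" using assms(3) by blast
  have eq: "group_index G W = group_index G U * group_index (G\<lparr>carrier := U\<rparr>) W"
    by (rule group_index_mult) (use assms in auto)
  have pos: "group_index G U > 0" "group_index G W > 0"
    using group_index_pos assms finite_rcosets_mono[OF assms(1,2) sub assms(4)] by auto
  obtain u where u: "u \<in> U" "u \<notin> W" using assms(3) by blast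
  have uc: "u \<in> carrier G" using u assms(2) by (rule_tac subgroup.mem_carrier)
  have "W #> u \<noteq> W #> \<one>"
    using rcos_self[OF uc assms(1)] u coset_mult_one[OF subgroup.subset[OF assms(1)]] by auto
  moreover have "{W #> u, W #> \<one>} \<subseteq> rcosets\<^bsub>G\<lparr>carrier := U\<rparr>\<^esub> W"
    using u subgroup.one_closed[OF assms(2)] by (auto simp: rcosets_carrier_update)
  moreover have "finite (rcosets\<^bsub>G\<lparr>carrier := U\<rparr>\<^esub> W)"
    using eq pos by (intro card_ge_0_finite) (simp add: group_index_def)
  ultimately have "2 \<le> group_index (G\<lparr>carrier := U\<rparr>) W"
    unfolding group_index_def by (metis card_2_iff card_mono)
  then show ?thesis using eq pos by simp
qed

text \<open>Every overgroup is a union of right cosets of \<open>W\<close>, and finitely many cosets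
  have finitely many unions.\<close>

lemma finite_overgroups:
  assumes "subgroup W G" "finite (rcosets W)"
  shows "finite {K. subgroup K G \<and> W \<subseteq> K}"
proof (rule finite_subset)
  show "{K. subgroup K G \<and> W \<subseteq> K} \<subseteq> Union ` Pow (rcosets W)"
  proof safe
    fix K assume K: "subgroup K G" "W \<subseteq> K"
    have "W #> k \<subseteq> K" if "k \<in> K" for k
      using K that by (auto simp: r_coset_def intro: subgroup.m_closed)
    moreover have "k \<in> W #> k" if "k \<in> K" for k
      using that K by (intro rcos_self assms) (auto dest: subgroup.mem_carrier)
    ultimately have "K = \<Union>((\<lambda>k. W #> k) ` K)" by blast
    moreover have "(\<lambda>k. W #> k) ` K \<in> Pow (rcosets W)"
      using K by (auto simp: RCOSETS_def dest: subgroup.mem_carrier)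
    ultimately show "K \<in> Union ` Pow (rcosets W)" by blast
  qed
  show "finite (Union ` Pow (rcosets W))" using assms(2) by simp
qed

text \<open>The conjugate g V g^-1 depends only on the coset g V, as \<open>V\<close> normalizes
  itself.\<close>

lemma finite_conjugacy_class:
  assumes "subgroup V G" "finite (rcosets V)"
  shows "finite (conjugacy_class G V)"
proof -
  have V: "V \<subseteq> carrier G" using assms(1) by (rule subgroup.subset)
  have "conjugate G g V = conjugate G (SOME x. x \<in> g <# V) V" if g: "g \<in> carrier G" for g
  proof -
    have "(SOME x. x \<in> g <# V) \<in> g <# V" using lcos_self[OF g assms(1)] by (rule someI)
    then obtain v where v: "v \<in> V" "(SOME x. x \<in> g <# V) = g \<otimes> v" by (auto simp: l_coset_def)
    moreover have "v \<in> carrier G" using v V by auto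
    moreover have "conjugate G v V = V"
      using subset_normalizer[OF assms(1)] v V by (auto simp: normalizer_eq)
    ultimately show ?thesis using g V by (simp flip: conjugate_conjugate)
  qed
  then have "conjugacy_class G V \<subseteq> (\<lambda>C. conjugate G (SOME x. x \<in> C) V) ` (lcosets V)"
    unfolding conjugacy_class_eq LCOSETS_def by blast
  then show ?thesis using finite_lcosets[OF assms] finite_surj by blast
qed

lemma rep_eq_conjugacy_class:
  assumes "V \<subseteq> carrier G" "c = conjugacy_class G V"
  obtains g where "g \<in> carrier G" "rep c = conjugate G g V" "conjugacy_class G (rep c) = c"
  using rep_conjugacy_class[OF assms(1)] conjugacy_class_conjugate[OF assms(1)] assms(2) by metis

end

context profinite_group
begin

lemma continuous_map_mult:
  "continuous_map T T f \<Longrightarrow> continuous_map T T h \<Longrightarrow> continuous_map T T (\<lambda>x. f x \<otimes> h x)"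
  using continuous_map_compose[OF continuous_map_pairedI continuous_mult, of T f h]
  by (simp add: o_def)

lemma continuous_map_carrier_const: "g \<in> carrier G \<Longrightarrow> continuous_map T T (\<lambda>x. g)"
  by (simp add: topspace_eq)

lemma open_subgroup_subset: "open_subgroup G T V \<Longrightarrow> V \<subseteq> carrier G"
  by (auto simp: open_subgroup_def dest: subgroup.subset)

text \<open>The cosets form an open cover of a compact space by disjoint nonempty sets, so a finite
  subcover already contains all of them.\<close>

lemma finite_rcosets_open_subgroup:
  assumes "open_subgroup G T V"
  shows "finite (rcosets V)"
proof -
  have V: "subgroup V G" "openin T V" and VG: "V \<subseteq> carrier G"
    using assms open_subgroup_subset by (auto simp: open_subgroup_def)
  have "openin T (V #> g)" if g: "g \<in> carrier G" for g
  proof -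
    have "continuous_map T T (\<lambda>x. x \<otimes> inv g)"
      using g by (intro continuous_map_mult continuous_map_carrier_const) auto
    then have "openin T {x \<in> topspace T. x \<otimes> inv g \<in> V}"
      using V(2) by (rule openin_continuous_map_preimage)
    also have "{x \<in> topspace T. x \<otimes> inv g \<in> V} = V #> g"
      using g VG by (auto simp: r_coset_mem_iff topspace_eq)
    finally show ?thesis .
  qed
  then have "\<forall>C \<in> rcosets V. openin T C" by (auto simp: RCOSETS_def)
  moreover have "\<Union>(rcosets V) = topspace T"
    using rcosets_part_G[OF V(1)] by (simp add: topspace_eq)
  ultimately obtain F where F: "finite F" "F \<subseteq> rcosets V" "\<Union>F = topspace T"
    using compact unfolding compact_space by meson
  have "C \<in> F" if C: "C \<in> rcosets V" for C
  proof -
    obtain x where x: "x \<in> C" using subgroup.rcosets_non_empty[OF V(1) C] by blast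
    then have "x \<in> topspace T" using C rcosets_part_G[OF V(1)] topspace_eq by blast
    then obtain D where D: "D \<in> F" "x \<in> D" using F(3) by blast
    then have "C = D"
      using rcos_disjoint[OF V(1)] C x F(2) by (auto simp: pairwise_def disjnt_def)
    then show ?thesis using D by simp
  qed
  then have "rcosets V \<subseteq> F" by blast
  then show ?thesis using F(1) by (rule finite_subset)
qed

lemma open_subgroup_conjugate:
  assumes "open_subgroup G T V" "g \<in> carrier G"
  shows "open_subgroup G T (conjugate G g V)"
proof -
  have V: "subgroup V G" "openin T V" and VG: "V \<subseteq> carrier G"
    using assms open_subgroup_subset by (auto simp: open_subgroup_def)
  have "continuous_map T T (\<lambda>x. inv g \<otimes> x \<otimes> g)"
    using assms(2)
    by (intro continuous_map_mult continuous_map_carrier_const) auto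
  then have "openin T {x \<in> topspace T. inv g \<otimes> x \<otimes> g \<in> V}"
    using V(2) by (rule openin_continuous_map_preimage)
  also have "{x \<in> topspace T. inv g \<otimes> x \<otimes> g \<in> V} = conjugate G g V"
    using assms(2) VG by (auto simp: conjugate_mem_iff topspace_eq)
  finally show ?thesis using subgroup_conjugate[OF V(1) assms(2)] by (simp add: open_subgroup_def)
qed

lemma open_classes_rep:
  assumes "c \<in> open_classes G T"
  shows "open_subgroup G T (rep c)" "conjugacy_class G (rep c) = c"
proof -
  obtain V where V: "open_subgroup G T V" "c = conjugacy_class G V"
    using assms by (auto simp: open_classes_def)
  then show "open_subgroup G T (rep c)" "conjugacy_class G (rep c) = c"
    using rep_eq_conjugacy_class[OF open_subgroup_subset[OF V(1)] V(2)] open_subgroup_conjugate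
    by metis+
qed

lemma class_le_conjugacy_class_iff:
  assumes "open_subgroup G T V"
  shows "class_le G (conjugacy_class G V) c \<longleftrightarrow> (\<exists>g\<in>carrier G. rep c \<subseteq> conjugate G g V)"
proof -
  note V = open_subgroup_subset[OF assms]
  obtain h where h: "h \<in> carrier G" "rep (conjugacy_class G V) = conjugate G h V"
    using rep_conjugacy_class[OF V] .
  show ?thesis
  proof
    assume "class_le G (conjugacy_class G V) c"
    then obtain g where "g \<in> carrier G" "rep c \<subseteq> conjugate G g (conjugate G h V)"
      by (auto simp: class_le_iff h)
    then show "\<exists>g\<in>carrier G. rep c \<subseteq> conjugate G g V"
      using h V by (auto simp: conjugate_conjugate intro!: bexI[of _ "g \<otimes> h"])
  next
    assume "\<exists>g\<in>carrier G. rep c \<subseteq> conjugate G g V"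
    then obtain g where "g \<in> carrier G" "rep c \<subseteq> conjugate G g V" by blast
    then show "class_le G (conjugacy_class G V) c"
      using h V by (auto simp: class_le_iff conjugate_conjugate m_assoc intro!: bexI[of _ "g \<otimes> inv h"])
  qed
qed

text \<open>Each class below \<open>c\<close> contains an overgroup of \<open>rep c\<close>. This
  makes the sum in the ghost map a genuine one; over an infinite range \<open>finsum\<close> would
  be zero by convention.\<close>

lemma finite_classes_below:
  assumes "c \<in> open_classes G T"
  shows "finite {d \<in> open_classes G T. class_le G d c}"
proof (rule finite_subset)
  note c = open_classes_rep[OF assms]
  show "{d \<in> open_classes G T. class_le G d c} \<subseteq>
    conjugacy_class G ` {K. subgroup K G \<and> rep c \<subseteq> K}"
  proof safe
    fix d assume d: "d \<in> open_classes G T" "class_le G d c"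
    then obtain g where g: "g \<in> carrier G" "rep c \<subseteq> conjugate G g (rep d)"
      by (auto simp: class_le_iff)
    note r = open_classes_rep[OF d(1)]
    have "conjugacy_class G (conjugate G g (rep d)) = d"
      using r g by (simp add: conjugacy_class_conjugate open_subgroup_subset)
    then show "d \<in> conjugacy_class G ` {K. subgroup K G \<and> rep c \<subseteq> K}"
      using g open_subgroup_conjugate[OF r(1) g(1)] unfolding open_subgroup_def by blast
  qed
  show "finite (conjugacy_class G ` {K. subgroup K G \<and> rep c \<subseteq> K})"
    using c(1) finite_rcosets_open_subgroup[OF c(1)]
    by (intro finite_imageI finite_overgroups) (auto simp: open_subgroup_def)
qed

lemma rel_index_conjugate:
  assumes "subgroup V G" "g \<in> carrier G"
  shows "rel_index G (conjugate G g V) W = rel_index G V W"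
    "rel_index G W (conjugate G g V) = rel_index G W V"
  using assms by (simp_all add: rel_index_def group_index_conjugate)

end

section \<open>Open subgroups and classes inside a fixed open subgroup\<close>

locale open_subgroup_of_profinite_group = profinite_group +
  fixes U
  assumes U: "open_subgroup G T U"
begin

abbreviation "GU \<equiv> G\<lparr>carrier := U\<rparr>"
abbreviation "TU \<equiv> subtopology T U"

lemma subgroup_U: "subgroup U G" and openin_U: "openin T U"
  using U by (auto simp: open_subgroup_def)

sublocale U: subgroup U G by (rule subgroup_U)
sublocale GU: group GU by (rule subgroup_imp_group[OF subgroup_U])

text \<open>As \<open>U\<close> is open, a subset of \<open>U\<close> is open in the subspace iff it
  is open in \<open>T\<close>. Topological facts about subgroups of \<open>U\<close> can thus be
  taken from \<open>G\<close>.\<close>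

lemma open_subgroup_U_iff: "open_subgroup GU TU V \<longleftrightarrow> open_subgroup G T V \<and> V \<subseteq> U"
  using openin_open_subtopology[OF openin_U]
  by (auto simp: open_subgroup_def subgroup_subset_carrier_update subgroup_U)

lemma open_classes_U_rep:
  assumes "e \<in> open_classes GU TU"
  shows "open_subgroup G T (rep e)" "rep e \<subseteq> U" "conjugacy_class GU (rep e) = e"
proof -
  obtain V where V: "open_subgroup G T V" "V \<subseteq> U" "e = conjugacy_class GU V"
    using assms by (auto simp: open_classes_def open_subgroup_U_iff)
  then obtain u where u: "u \<in> U" "rep e = conjugate GU u V" "conjugacy_class GU (rep e) = e"
    using GU.rep_eq_conjugacy_class[of V e] by auto
  then show "open_subgroup G T (rep e)" "rep e \<subseteq> U" "conjugacy_class GU (rep e) = e"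
    using V open_subgroup_conjugate[OF V(1)] GU.conjugate_subset[of V u]
    by (auto simp: conjugate_carrier_update[OF subgroup_U])
qed

lemma conjugacy_class_in_open_classes:
  "e \<in> open_classes GU TU \<Longrightarrow> conjugacy_class G (rep e) \<in> open_classes G T"
  using open_classes_U_rep(1) by (auto simp: open_classes_def)

text \<open>Replaces the test on a chosen representative by a condition on arbitrary subgroups. This
  is the form of \<open>S\<close> in \<open>mark_eq_sum_normalizer_index\<close>, and it also yields
  finiteness.\<close>

lemma classes_over_eq:
  assumes "c \<in> open_classes G T"
  shows "classes_over G T U c =
    conjugacy_class GU ` {K. K \<subseteq> U \<and> K \<in> conjugacy_class G (rep c)}"
proof (intro equalityI subsetI)
  fix d assume "d \<in> classes_over G T U c"
  then have d: "d \<in> open_classes GU TU" "conjugacy_class G (rep d) = c"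
    by (auto simp: classes_over_def)
  note r = open_classes_U_rep[OF d(1)]
  have "rep d \<in> c"
    using mem_conjugacy_class_self[OF open_subgroup_subset[OF r(1)]] d(2) by simp
  then show "d \<in> conjugacy_class GU ` {K. K \<subseteq> U \<and> K \<in> conjugacy_class G (rep c)}"
    using r open_classes_rep(2)[OF assms] by (intro image_eqI[of _ _ "rep d"]) auto
next
  note c = open_classes_rep[OF assms]
  fix d assume "d \<in> conjugacy_class GU ` {K. K \<subseteq> U \<and> K \<in> conjugacy_class G (rep c)}"
  then obtain g where g: "g \<in> carrier G" "conjugate G g (rep c) \<subseteq> U"
    "d = conjugacy_class GU (conjugate G g (rep c))"
    by (auto simp: conjugacy_class_eq[of G])
  let ?K = "conjugate G g (rep c)"
  have K: "open_subgroup G T ?K" by (rule open_subgroup_conjugate[OF c(1) g(1)])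
  obtain u where u: "u \<in> U" "rep d = conjugate GU u ?K"
    using GU.rep_conjugacy_class[of ?K] g by auto
  then have "conjugacy_class G (rep d) = c"
    using K c g by (simp add: conjugate_carrier_update[OF subgroup_U] conjugacy_class_conjugate
        open_subgroup_subset)
  moreover have "d \<in> open_classes GU TU"
    using K g by (auto simp: open_classes_def open_subgroup_U_iff)
  ultimately show "d \<in> classes_over G T U c" by (simp add: classes_over_def)
qed

lemma finite_classes_over:
  assumes "c \<in> open_classes G T"
  shows "finite (classes_over G T U c)"
proof -
  note c = open_classes_rep[OF assms]
  have "finite (conjugacy_class G (rep c))"
    using c(1) finite_rcosets_open_subgroup[OF c(1)]
    by (intro finite_conjugacy_class) (auto simp: open_subgroup_def)
  then show ?thesis by (simp add: classes_over_eq[OF assms])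
qed

text \<open>Both indices in \<open>G\<close> are (G : U) times those in \<open>U\<close>, and the
  common positive factor cancels in the quotient. For this reason the powers of \<open>q\<close> and
  the Adams operations agree in the ghost maps of \<open>U\<close> and of \<open>G\<close>.\<close>

lemma rel_index_U:
  assumes "open_subgroup G T V" "V \<subseteq> U" "open_subgroup G T W" "W \<subseteq> U"
  shows "rel_index GU V W = rel_index G V W"
proof -
  have mult: "group_index G K = group_index G U * group_index GU K"
    if "open_subgroup G T K" "K \<subseteq> U" for K
    using that finite_rcosets_open_subgroup[OF that(1)] subgroup_U
    by (intro group_index_mult) (auto simp: open_subgroup_def)
  have "group_index G U > 0"
    using group_index_pos[OF subgroup_U finite_rcosets_open_subgroup[OF U]] .
  then show ?thesis using assms by (simp add: rel_index_def mult)
qed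

lemma mark_eq_sum_classes_over:
  assumes "c \<in> open_classes G T" "open_subgroup G T V" "V \<subseteq> U"
  shows "mark G (rep c) V =
    (\<Sum>f\<in>classes_over G T U c. normalizer_index G U (rep f) * mark GU (rep f) V)"
proof -
  note c = open_classes_rep[OF assms(1)]
  show ?thesis
    using assms c finite_rcosets_open_subgroup
      mark_eq_sum_normalizer_index[OF subgroup_U _ assms(3) _ _ _
        finite_classes_over[OF assms(1)] classes_over_eq[OF assms(1)]]
    by (auto simp: open_subgroup_def)
qed

end

section \<open>Ghost maps and induction\<close>

lemma (in abelian_group) add_pow_int_0 [simp]: "[(0::int)] \<cdot> a = \<zero>"
  by (simp add: add_pow_int_ge)

lemma (in abelian_group) add_pow_int_finsum:
  assumes "f \<in> I \<rightarrow> carrier G"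
  shows "[(k::int)] \<cdot> (\<Oplus>i\<in>I. f i) = (\<Oplus>i\<in>I. [k] \<cdot> f i)"
  using assms
proof (induction I rule: infinite_finite_induct)
  case (insert i I)
  then show ?case by (simp add: Pi_def add.int_pow_distrib)
qed simp_all

lemma (in abelian_group) finsum_add_pow_int:
  assumes "finite I" "a \<in> carrier G"
  shows "(\<Oplus>i\<in>I. [(k i :: int)] \<cdot> a) = [(\<Sum>i\<in>I. k i)] \<cdot> a"
  using assms by (induction I) (simp_all add: Pi_def add.int_pow_mult)

lemma (in abelian_group) add_pow_int_nat: "[int n] \<cdot> a = [n] \<cdot> a"
  by (simp add: add_pow_int_ge)

text \<open>Taking subgroups instead of classes as arguments lets the same summand be evaluated at
  representatives of classes of \<open>G\<close> and of classes of \<open>U\<close>.\<close>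

definition ghost_term ::
    "int \<Rightarrow> ('g, 'm) monoid_scheme \<Rightarrow> ('a, 'b) ring_scheme \<Rightarrow> (nat \<Rightarrow> 'a \<Rightarrow> 'a) \<Rightarrow>
      'g set \<Rightarrow> 'g set \<Rightarrow> 'a \<Rightarrow> 'a"
  where "ghost_term q G A lam W V a =
    [(int (mark G W V) * q ^ (rel_index G V W - 1))] \<cdot>\<^bsub>A\<^esub> adams A lam (rel_index G V W) a"

lemma ghost_map_eq:
  "c \<in> open_classes G T \<Longrightarrow> ghost_map q G T A lam x c =
    (\<Oplus>\<^bsub>A\<^esub>d \<in> {d \<in> open_classes G T. class_le G d c}. ghost_term q G A lam (rep c) (rep d) (x d))"
  by (simp add: ghost_map_def ghost_term_def)

context lambda_ring
begin

lemma ghost_term_closed: "a \<in> carrier R \<Longrightarrow> ghost_term q G R lam W V a \<in> carrier R"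
  by (simp add: ghost_term_def adams_closed)

lemma ghost_term_finsum:
  assumes "f \<in> I \<rightarrow> carrier R"
  shows "ghost_term q G R lam W V (\<Oplus>i\<in>I. f i) = (\<Oplus>i\<in>I. ghost_term q G R lam W V (f i))"
proof -
  have "(\<lambda>i. adams R lam n (f i)) \<in> I \<rightarrow> carrier R" for n
    using assms by (auto simp: Pi_iff intro: adams_closed)
  then show ?thesis
    using assms by (simp add: ghost_term_def adams_finsum add_pow_int_finsum)
qed

end

section \<open>Injectivity of the ghost map\<close>

context profinite_group
begin

lemma rel_index_self:
  assumes "open_subgroup G T V"
  shows "rel_index G V V = 1"
  using group_index_pos[OF _ finite_rcosets_open_subgroup[OF assms]] assms
  by (simp add: rel_index_def open_subgroup_def)

lemma class_le_refl:
  assumes "c \<in> open_classes G T"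
  shows "class_le G c c"
  using open_subgroup_subset[OF open_classes_rep(1)[OF assms]]
  by (auto simp: class_le_iff intro!: bexI[of _ \<one>])

lemma class_le_group_index:
  assumes "d \<in> open_classes G T" "c \<in> open_classes G T" "class_le G d c" "d \<noteq> c"
  shows "group_index G (rep d) < group_index G (rep c)"
proof -
  note d = open_classes_rep[OF assms(1)] and c = open_classes_rep[OF assms(2)]
  obtain g where g: "g \<in> carrier G" "rep c \<subseteq> conjugate G g (rep d)"
    using assms(3) by (auto simp: class_le_iff)
  have "conjugacy_class G (conjugate G g (rep d)) = d"
    using g d by (simp add: conjugacy_class_conjugate open_subgroup_subset)
  then have "rep c \<noteq> conjugate G g (rep d)" using assms(4) c(2) by auto
  then have "rep c \<subset> conjugate G g (rep d)" using g by blast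
  moreover have "subgroup (rep c) G" "subgroup (rep d) G" using c d by (auto simp: open_subgroup_def)
  ultimately have "group_index G (conjugate G g (rep d)) < group_index G (rep c)"
    using finite_rcosets_open_subgroup[OF c(1)] g
    by (intro group_index_strict_mono) (auto simp: subgroup_conjugate)
  then show ?thesis using \<open>subgroup (rep d) G\<close> g by (simp add: group_index_conjugate)
qed

text \<open>The ghost map is triangular for the index: its diagonal coefficient at \<open>c\<close> is
  \<open>\<phi>\<^sub>V(G/V) \<cdot> q\<^sup>0\<close> with \<open>V = rep c\<close>, a positive integer even if \<open>q = 0\<close>.\<close>

lemma inj_on_ghost_map:
  fixes A :: "(rat, 'r, 's) module_scheme"
  assumes "lambda_ring A lam" "algebra (ring_of_type_algebra :: rat ring) A"
  shows "inj_on (ghost_map q G T A lam) (class_functions G T A)"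
proof (rule inj_onI)
  interpret A: lambda_ring A lam by fact
  fix x y
  assume xy: "x \<in> class_functions G T A" "y \<in> class_functions G T A"
    and eq: "ghost_map q G T A lam x = ghost_map q G T A lam y"
  have closed: "x c \<in> carrier A" "y c \<in> carrier A" if "c \<in> open_classes G T" for c
    using xy that by (auto simp: class_functions_def)
  have "x c = y c" if "c \<in> open_classes G T" for c
    using that
  proof (induction "group_index G (rep c)" arbitrary: c rule: less_induct)
    case less
    \<comment> \<open>Classes strictly below \<open>c\<close> have representatives of strictly
      smaller index, so the induction hypothesis makes \<open>x\<close> and \<open>y\<close> agree
      on \<open>D\<close>, and only the diagonal terms remain.\<close>
    define D where "D = {d \<in> open_classes G T. class_le G d c} - {c}"
    define t where "t z d = ghost_term q G A lam (rep c) (rep d) (z d)" for z d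
    define s where "s = (\<Oplus>\<^bsub>A\<^esub>d\<in>D. t y d)"
    let ?m = "mark G (rep c) (rep c)"
    note c = open_classes_rep[OF less.prems]
    have D: "{d \<in> open_classes G T. class_le G d c} = insert c D" "finite D" "c \<notin> D"
      using class_le_refl finite_classes_below less.prems by (auto simp: D_def)
    have tc: "t x d \<in> carrier A" "t y d \<in> carrier A" if "d \<in> insert c D" for d
      using that D(1) closed by (auto simp: t_def intro!: A.ghost_term_closed)
    have sum: "ghost_map q G T A lam z c = t z c \<oplus>\<^bsub>A\<^esub> (\<Oplus>\<^bsub>A\<^esub>d\<in>D. t z d)"
      if "z = x \<or> z = y" for z
    proof -
      have tc': "t z d \<in> carrier A" if "d \<in> insert c D" for d
        using \<open>z = x \<or> z = y\<close> tc that by auto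
      then show ?thesis
        unfolding ghost_map_eq[OF less.prems] D(1) t_def[symmetric]
        using D(2,3) by (subst A.finsum_insert) auto
    qed
    have "x d = y d" if "d \<in> D" for d
      using that less class_le_group_index by (auto simp: D_def)
    then have sx: "(\<Oplus>\<^bsub>A\<^esub>d\<in>D. t x d) = s"
      unfolding s_def using tc by (intro A.finsum_cong') (auto simp: t_def)
    have sc: "s \<in> carrier A" unfolding s_def using tc by (intro A.finsum_closed) auto
    have "t x c \<oplus>\<^bsub>A\<^esub> s = t y c \<oplus>\<^bsub>A\<^esub> s"
      using sum[of x] sum[of y] eq sx by (simp add: s_def)
    then have txy: "t x c = t y c" using tc sc by simp
    have diag: "t z c = [?m] \<cdot>\<^bsub>A\<^esub> z c" if "z c \<in> carrier A" for z
      using that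
      by (simp add: t_def ghost_term_def rel_index_self[OF c(1)] A.adams_1[simplified] A.add_pow_int_nat)
    have xyc: "x c \<in> carrier A" "y c \<in> carrier A" using closed less.prems by auto
    \<comment> \<open>Torsion-freeness is about one element killed by an integer, so the equality of
      the two multiples is turned into a statement about the difference.\<close>
    let ?d = "x c \<ominus>\<^bsub>A\<^esub> y c"
    have "[?m] \<cdot>\<^bsub>A\<^esub> ?d \<oplus>\<^bsub>A\<^esub> [?m] \<cdot>\<^bsub>A\<^esub> y c = [?m] \<cdot>\<^bsub>A\<^esub> (?d \<oplus>\<^bsub>A\<^esub> y c)"
      using xyc by (simp add: A.add.nat_pow_distrib)
    also have "?d \<oplus>\<^bsub>A\<^esub> y c = x c" using xyc by (simp add: A.minus_eq A.a_assoc A.l_neg)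
    also have "[?m] \<cdot>\<^bsub>A\<^esub> x c = [?m] \<cdot>\<^bsub>A\<^esub> y c"
      using txy unfolding diag[of x, OF xyc(1)] diag[of y, OF xyc(2)] .
    finally have eq0: "[?m] \<cdot>\<^bsub>A\<^esub> ?d = \<zero>\<^bsub>A\<^esub>" using xyc by simp
    have pos: "?m > 0"
      using c(1) finite_rcosets_open_subgroup[OF c(1)]
      by (intro mark_self_pos) (auto simp: open_subgroup_def)
    have "?d \<in> carrier A" using xyc by simp
    from rat_algebra_torsion_free[OF assms(2) this pos eq0] show "x c = y c" using xyc by simp
  qed
  then show "x = y"
    using xy unfolding class_functions_def by (auto intro: PiE_ext)
qed

end

section \<open>Compatibility of the ghost maps with the two inductions\<close>

context open_subgroup_of_profinite_group
begin

lemma classical_ind_closed: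
  assumes "lambda_ring A lam" "x \<in> class_functions GU TU A"
  shows "classical_ind G T U A x \<in> class_functions G T A"
proof -
  interpret A: lambda_ring A lam by fact
  have "x e \<in> carrier A" if "e \<in> open_classes GU TU" for e
    using assms(2) that by (auto simp: class_functions_def)
  then show ?thesis
    by (auto simp: class_functions_def classical_ind_def classes_over_def intro!: A.finsum_closed)
qed

text \<open>Both sides become one sum over a set \<open>E\<close> of classes of \<open>U\<close>. On
  the left it arises by grouping according to the class generated in \<open>G\<close>; on the right
  by enlarging all inner sums to the range \<open>E\<close> and exchanging the order of
  summation.\<close>

lemma ghost_map_classical_ind:
  assumes "lambda_ring A lam" "x \<in> class_functions GU TU A"
  shows "ghost_map q G T A lam (classical_ind G T U A x) =
    ghost_ind G T U A (ghost_map q GU TU A lam x)"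
proof
  interpret A: lambda_ring A lam by fact
  have xc: "x e \<in> carrier A" if "e \<in> open_classes GU TU" for e
    using assms(2) that by (auto simp: class_functions_def)
  fix c
  show "ghost_map q G T A lam (classical_ind G T U A x) c =
    ghost_ind G T U A (ghost_map q GU TU A lam x) c"
  proof (cases "c \<in> open_classes G T")
    case False
    then show ?thesis by (simp add: ghost_map_def ghost_ind_def)
  next
    case c: True
    define W where "W = rep c"
    note repc = open_classes_rep[OF c, folded W_def]
    have WG: "W \<subseteq> carrier G" using repc open_subgroup_subset by blast
    define D where "D = {d \<in> open_classes G T. class_le G d c}"
    define S where "S = classes_over G T U c"
    \<comment> \<open>The classes of \<open>U\<close> whose members contain a
      \<open>G\<close>-conjugate of \<open>W\<close>. The condition does not refer to a class over
      \<open>c\<close>, so \<open>E\<close> can be the common range of all inner sums of the ghost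
      side.\<close>
    define E where "E = (\<Union>d\<in>D. classes_over G T U d)"
    define t where "t e = ghost_term q G A lam W (rep e) (x e)" for e
    have finD: "finite D" unfolding D_def by (rule finite_classes_below[OF c])
    have finS: "finite S" unfolding S_def by (rule finite_classes_over[OF c])
    have E_eq: "E = {e \<in> open_classes GU TU. \<exists>g\<in>carrier G. W \<subseteq> conjugate G g (rep e)}"
    proof -
      have "e \<in> E \<longleftrightarrow> e \<in> open_classes GU TU \<and> conjugacy_class G (rep e) \<in> D" for e
        by (auto simp: E_def classes_over_def)
      moreover have "conjugacy_class G (rep e) \<in> D \<longleftrightarrow> (\<exists>g\<in>carrier G. W \<subseteq> conjugate G g (rep e))"
        if "e \<in> open_classes GU TU" for e
        using that conjugacy_class_in_open_classes
        by (simp add: D_def W_def class_le_conjugacy_class_iff open_classes_U_rep(1))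
      ultimately show ?thesis by blast
    qed
    have finE: "finite E" unfolding E_def using finD finite_classes_over by (auto simp: D_def)
    have E_U: "e \<in> open_classes GU TU" if "e \<in> E" for e using that by (simp add: E_eq)
    have tc: "t e \<in> carrier A" if "e \<in> open_classes GU TU" for e
      using that xc by (simp add: t_def A.ghost_term_closed)
    have S_D: "rep f \<subseteq> U" "open_subgroup G T (rep f)" "\<exists>g\<in>carrier G. rep f = conjugate G g W"
      if f: "f \<in> S" for f
    proof -
      have fU: "f \<in> open_classes GU TU" "conjugacy_class G (rep f) = c"
        using f by (auto simp: S_def classes_over_def)
      note r = open_classes_U_rep[OF fU(1)]
      show "rep f \<subseteq> U" "open_subgroup G T (rep f)" using r by auto
      show "\<exists>g\<in>carrier G. rep f = conjugate G g W"
        using conjugacy_class_eq_iff[OF open_subgroup_subset[OF r(1)] WG] fU(2) repc(2)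
        by simp
    qed
    have lhs: "ghost_map q G T A lam (classical_ind G T U A x) c = (\<Oplus>\<^bsub>A\<^esub>e\<in>E. t e)"
    proof -
      have "ghost_term q G A lam W (rep d) (classical_ind G T U A x d) =
        (\<Oplus>\<^bsub>A\<^esub>e\<in>classes_over G T U d. t e)" if d: "d \<in> D" for d
      proof -
        have dO: "d \<in> open_classes G T" using d by (simp add: D_def)
        have "ghost_term q G A lam W (rep d) (classical_ind G T U A x d) =
          (\<Oplus>\<^bsub>A\<^esub>e\<in>classes_over G T U d. ghost_term q G A lam W (rep d) (x e))"
          using dO xc by (simp add: classical_ind_def classes_over_def A.ghost_term_finsum)
        also have "\<dots> = (\<Oplus>\<^bsub>A\<^esub>e\<in>classes_over G T U d. t e)"
        proof (rule A.finsum_cong')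
          fix e assume "e \<in> classes_over G T U d"
          then have e: "e \<in> open_classes GU TU" "d = conjugacy_class G (rep e)"
            by (auto simp: classes_over_def)
          note r = open_classes_U_rep(1)[OF e(1)]
          \<comment> \<open>\<open>rep d\<close> and \<open>rep e\<close> may differ, but they are
            conjugate in \<open>G\<close>, and neither marks nor indices see the difference.\<close>
          obtain g where g: "g \<in> carrier G" "rep d = conjugate G g (rep e)"
            using rep_conjugacy_class[OF open_subgroup_subset[OF r]] e(2) by auto
          have "subgroup (rep e) G" using r by (simp add: open_subgroup_def)
          then show "ghost_term q G A lam W (rep d) (x e) = t e"
            using g WG by (simp add: t_def ghost_term_def mark_conjugate rel_index_conjugate)
        qed (auto simp: classes_over_def tc)
        finally show ?thesis .
      qed
      then have "ghost_map q G T A lam (classical_ind G T U A x) c =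
        (\<Oplus>\<^bsub>A\<^esub>d\<in>D. \<Oplus>\<^bsub>A\<^esub>e\<in>classes_over G T U d. t e)"
        unfolding ghost_map_eq[OF c] D_def[symmetric] W_def[symmetric]
        using tc by (intro A.finsum_cong') (auto simp: classes_over_def intro!: A.finsum_closed)
      also have "\<dots> = (\<Oplus>\<^bsub>A\<^esub>e\<in>E. t e)"
        unfolding E_def
        by (rule A.add.finprod_UN_disjoint[symmetric])
          (use finD finite_classes_over tc in
            \<open>auto simp: D_def classes_over_def pairwise_def disjnt_def\<close>)
      finally show ?thesis .
    qed
    \<comment> \<open>The index is taken in \<open>G\<close> at \<open>W\<close>, once for all
      \<open>f\<close> in \<open>S\<close>: it equals the index in \<open>U\<close> at each
      \<open>rep f\<close>. So \<open>a e\<close> is independent of \<open>f\<close>, and only the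
      mark in \<open>k f e\<close> varies.\<close>
    define r where "r e = rel_index G (rep e) W" for e
    define a where "a e = adams A lam (r e) (x e)" for e
    define k where "k f e = int (mark GU (rep f) (rep e)) * q ^ (r e - 1)" for f e
    have ac: "a e \<in> carrier A" if "e \<in> E" for e
      using E_U[OF that] xc by (simp add: a_def A.adams_closed)
    have inner: "ghost_map q GU TU A lam x f = (\<Oplus>\<^bsub>A\<^esub>e\<in>E. [(k f e)] \<cdot>\<^bsub>A\<^esub> a e)"
      if f: "f \<in> S" for f
    proof -
      have fU: "f \<in> open_classes GU TU" using f by (auto simp: S_def classes_over_def)
      obtain g where g: "g \<in> carrier G" "rep f = conjugate G g W" using S_D(3)[OF f] by blast
      have W: "subgroup W G" using repc by (simp add: open_subgroup_def)
      have le: "class_le GU e f \<longleftrightarrow> (\<exists>u\<in>U. rep f \<subseteq> conjugate GU u (rep e))" for e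
        by (simp add: class_le_iff)
      show ?thesis
        unfolding ghost_map_eq[OF fU]
      \<comment> \<open>The range grows from the classes below \<open>f\<close> in \<open>U\<close>
        to \<open>E\<close>: in an additional summand no \<open>U\<close>-conjugate of
        \<open>rep e\<close> contains \<open>rep f\<close>, so its mark is 0.\<close>
      proof (rule A.add.finprod_mono_neutral_cong_left[OF finE])
        show "{e \<in> open_classes GU TU. class_le GU e f} \<subseteq> E"
        proof safe
          fix e assume e: "e \<in> open_classes GU TU" "class_le GU e f"
          then obtain u where u: "u \<in> U" "rep f \<subseteq> conjugate G u (rep e)"
            unfolding le by (auto simp: conjugate_carrier_update[OF subgroup_U])
          have re: "rep e \<subseteq> carrier G" using open_classes_U_rep[OF e(1)] open_subgroup_subset by blast
          have "conjugate G (inv g) (rep f) \<subseteq> conjugate G (inv g) (conjugate G u (rep e))"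
            using u(2) by (rule conjugate_mono)
          then have "W \<subseteq> conjugate G (inv g \<otimes> u) (rep e)"
            using g WG u re by (simp add: conjugate_conjugate)
          then show "e \<in> E" using e g u by (auto simp: E_eq)
        qed
        show "[(k f e)] \<cdot>\<^bsub>A\<^esub> a e = \<zero>\<^bsub>A\<^esub>"
          if e: "e \<in> E - {e \<in> open_classes GU TU. class_le GU e f}" for e
        proof -
          have eU: "e \<in> open_classes GU TU" using e E_U by blast
          have "mark GU (rep f) (rep e) = 0"
            using e eU le[of e] S_D(1)[OF f] open_classes_U_rep[OF eU] subgroup_U
            by (intro GU.mark_eq_0) (auto simp: subgroup_subset_carrier_update open_subgroup_def)
          then show ?thesis by (simp add: k_def)
        qed
        show "ghost_term q GU A lam (rep f) (rep e) (x e) = [(k f e)] \<cdot>\<^bsub>A\<^esub> a e"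
          if e: "e \<in> {e \<in> open_classes GU TU. class_le GU e f}" for e
        proof -
          have eU: "e \<in> open_classes GU TU" using e by blast
          have "rel_index GU (rep e) (rep f) = r e"
            using open_classes_U_rep[OF eU] S_D[OF f] g W
            by (simp add: rel_index_U r_def rel_index_conjugate)
          then show ?thesis by (simp add: ghost_term_def k_def a_def)
        qed
        show "(\<lambda>e. [(k f e)] \<cdot>\<^bsub>A\<^esub> a e) \<in> E \<rightarrow> carrier A" using ac by auto
      qed
    qed
    have "ghost_ind G T U A (ghost_map q GU TU A lam x) c =
      (\<Oplus>\<^bsub>A\<^esub>f\<in>S. \<Oplus>\<^bsub>A\<^esub>e\<in>E. [(int (normalizer_index G U (rep f)) * k f e)] \<cdot>\<^bsub>A\<^esub> a e)"
    proof -
      have "[normalizer_index G U (rep f)] \<cdot>\<^bsub>A\<^esub> ghost_map q GU TU A lam x f =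
        (\<Oplus>\<^bsub>A\<^esub>e\<in>E. [(int (normalizer_index G U (rep f)) * k f e)] \<cdot>\<^bsub>A\<^esub> a e)"
        if f: "f \<in> S" for f
      proof -
        have "[normalizer_index G U (rep f)] \<cdot>\<^bsub>A\<^esub> ghost_map q GU TU A lam x f =
          (\<Oplus>\<^bsub>A\<^esub>e\<in>E. [(int (normalizer_index G U (rep f)))] \<cdot>\<^bsub>A\<^esub> ([(k f e)] \<cdot>\<^bsub>A\<^esub> a e))"
          using ac by (simp add: inner[OF f] A.add_pow_int_finsum Pi_iff flip: A.add_pow_int_nat)
        also have "\<dots> = (\<Oplus>\<^bsub>A\<^esub>e\<in>E. [(int (normalizer_index G U (rep f)) * k f e)] \<cdot>\<^bsub>A\<^esub> a e)"
          using ac by (intro A.finsum_cong') (auto simp: A.add.int_pow_pow mult.commute)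
        finally show ?thesis .
      qed
      then show ?thesis
        unfolding ghost_ind_def S_def[symmetric]
        using c ac by (auto simp: S_def[symmetric] intro!: A.finsum_cong' A.finsum_closed)
    qed
    also have "\<dots> = (\<Oplus>\<^bsub>A\<^esub>e\<in>E. \<Oplus>\<^bsub>A\<^esub>f\<in>S. [(int (normalizer_index G U (rep f)) * k f e)] \<cdot>\<^bsub>A\<^esub> a e)"
      using ac by (intro A.finsum_swap finS finE) auto
    also have "\<dots> = (\<Oplus>\<^bsub>A\<^esub>e\<in>E. t e)"
    proof (rule A.finsum_cong'[OF refl])
      fix e assume e: "e \<in> E"
      note re = open_classes_U_rep[OF E_U[OF e]]
      \<comment> \<open>Here the count of fixed points enters: the coefficients of the single
        element \<open>a e\<close> add up to the mark of \<open>W\<close> on the orbit of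
        \<open>rep e\<close>.\<close>
      have "(\<Sum>f\<in>S. int (normalizer_index G U (rep f)) * k f e) =
        int (mark G W (rep e)) * q ^ (r e - 1)"
        unfolding W_def mark_eq_sum_classes_over[OF c re(1,2)] S_def[symmetric]
        by (simp add: k_def sum_distrib_right mult.assoc)
      then show "(\<Oplus>\<^bsub>A\<^esub>f\<in>S. [(int (normalizer_index G U (rep f)) * k f e)] \<cdot>\<^bsub>A\<^esub> a e) = t e"
        using A.finsum_add_pow_int[OF finS ac[OF e]]
        by (simp add: t_def ghost_term_def r_def a_def)
    qed (use tc E_U in auto)
    finally show ?thesis using lhs by simp
  qed
qed

end

theorem theorem5p7:
  fixes q :: int
    and G :: "('g, 'm) monoid_scheme" and T :: "'g topology" and U :: "'g set"
    and A :: "(rat, 'a, 'b) module_scheme" and lam :: "nat \<Rightarrow> 'a \<Rightarrow> 'a"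
  assumes "profinite_group G T"
    and "special_lambda_ring A lam"
    and "algebra (ring_of_type_algebra :: rat ring) A"
    and "open_subgroup G T U"
  shows "\<forall>x \<in> class_functions (G\<lparr>carrier := U\<rparr>) (subtopology T U) A.
    q_ind q G T U A lam x = classical_ind G T U A x"
proof
  interpret profinite_group G T by fact
  interpret open_subgroup_of_profinite_group G T U by unfold_locales fact
  have A: "lambda_ring A lam" using assms(2) by (rule special_lambda_ring.axioms)
  fix x assume x: "x \<in> class_functions (G\<lparr>carrier := U\<rparr>) (subtopology T U) A"
  \<comment> \<open>The argument of \<open>inv_into\<close> is rewritten as the ghost vector of
    \<open>classical_ind G T U A x\<close>, a class function, so injectivity makes
    \<open>inv_into\<close> return it.\<close>
  show "q_ind q G T U A lam x = classical_ind G T U A x"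
    using inv_into_f_f[OF inj_on_ghost_map[OF A assms(3)] classical_ind_closed[OF A x]]
    by (simp add: q_ind_def flip: ghost_map_classical_ind[OF A x])
qed

end
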